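(* Let $n_1,n_2\ge2$, $n=n_1+n_2$, and let $\alpha,\beta>0$ be constants. Let $\mathbf{X}=(X_1,\dots,X_n)$ be a random vector with joint density $g$ on $\mathbb{R}^n$, and let $$T=\frac{\frac1{n_1}\sum_{i=1}^{n_1}X_i-\frac1{n_2}\sum_{i=n_1+1}^{n}X_i}{\sqrt{\alpha S_1^2+\beta S_2^2}}.$$ Suppose that $g$ is continuous, that $$g\big(r(\cos(\omega-\omega_0)\mathbf{I}_1+\sin(\omega-\omega_0)\mathbf{I}_2)\big)>0\quad\text{for some }r\ge0\text{ and }\omega\in[-\pi/2,\pi/2],$$ and that for some $\varepsilon>0$ $$\int_{-\pi/2}^{\pi/2}\cos(\omega)^{n-2}\int_0^\infty r^{n-1}\sup_{\|\boldsymbol\xi\|<\varepsilon,\ \boldsymbol\xi\in L^\perp}g\big(r(\cos(\omega-\omega_0)\mathbf{I}_1+\sin(\omega-\omega_0)\mathbf{I}_2+\boldsymbol\xi)\big)\,dr\,d\omega<\infty.$$ Then $$\frac{\mathbf{P}(T>u)}{t_{n-2}(u)}=K_g+o(1)\quad\text{as }u\to\infty,$$ where $$K_g=C(n_1,n_2,\alpha,\beta)\int_{-\pi/2}^{\pi/2}\cos(\omega)^{n-2}\int_0^\infty r^{n-1}g\big(r(\cos(\omega-\omega_0)\mathbf{I}_1+\sin(\omega-\omega_0)\mathbf{I}_2)\big)\,dr\,d\omega,$$ $$C(n_1,n_2,\alpha,\beta)=\frac{2\pi^{(n-1)/2}\left(\frac{n_1-1}{\alpha}\right)^{(n_1-1)/2}\left(\frac{n_2-1}{\beta}\right)^{(n_2-1)/2}\left(\frac1{n_1}+\frac1{n_2}\right)^{(n-2)/2}}{\Gamma\left(\frac{n-1}{2}\right)(n-2)^{(n-2)/2}},$$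 and $0<K_g<\infty$.
   Context: $S_1^2$ and $S_2^2$ are the sample variances (with divisors $n_1-1$ and $n_2-1$) of $(X_1,\dots,X_{n_1})$ and $(X_{n_1+1},\dots,X_n)$. $\mathbf{I}_1\in\mathbb{R}^n$ has its first $n_1$ coordinates equal to $1/\sqrt{n_1}$ and the remaining ones $0$; $\mathbf{I}_2\in\mathbb{R}^n$ has its first $n_1$ coordinates $0$ and its last $n_2$ coordinates equal to $1/\sqrt{n_2}$. $\omega_0=\arccos\sqrt{n_2/n}$. $L$ is the linear span of $\mathbf{I}_1,\mathbf{I}_2$ and $L^\perp$ its orthogonal complement in $\mathbb{R}^n$. $t_{n-2}(u)=\mathbf{P}(\tau>u)$ is the tail of the Student $t$-distribution with $n-2$ degrees of freedom. *)

theory Defs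
  imports "HOL-Probability.Probability" "HOL-Library.Landau_Symbols"
begin

text \<open>
  The sample space \<open>\<real>\<^sup>n\<close> with \<open>n = n\<^sub>1 + n\<^sub>2\<close> is the type \<open>real ^ ('m + 'n)\<close>, where
  \<open>n\<^sub>1 = CARD('m)\<close> and \<open>n\<^sub>2 = CARD('n)\<close>: the coordinates \<open>Inl i\<close> are the first \<open>n\<^sub>1\<close> ones,
  the coordinates \<open>Inr j\<close> the last \<open>n\<^sub>2\<close> ones.
\<close>

definition sample1 :: "real ^ ('m::finite + 'n::finite) \<Rightarrow> real ^ 'm" where
  "sample1 x = (\<chi> i. x $ Inl i)"

definition sample2 :: "real ^ ('m::finite + 'n::finite) \<Rightarrow> real ^ 'n" where
  "sample2 x = (\<chi> j. x $ Inr j)"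

definition sample_mean :: "real ^ 'k::finite \<Rightarrow> real" where
  "sample_mean y = (\<Sum>i\<in>UNIV. y $ i) / real CARD('k)"

definition sample_var :: "real ^ 'k::finite \<Rightarrow> real" where
  "sample_var y = (\<Sum>i\<in>UNIV. (y $ i - sample_mean y)\<^sup>2) / (real CARD('k) - 1)"

text \<open>Where both sample variances vanish the quotient takes the value 0; for a random vector
  with a density this is a null event.\<close>

definition T_stat :: "real \<Rightarrow> real \<Rightarrow> real ^ ('m::finite + 'n::finite) \<Rightarrow> real" where
  "T_stat \<alpha> \<beta> x = (sample_mean (sample1 x) - sample_mean (sample2 x)) /
     sqrt (\<alpha> * sample_var (sample1 x) + \<beta> * sample_var (sample2 x))"

definition I1 :: "real ^ ('m::finite + 'n::finite)" where
  "I1 = (\<chi> k. case k of Inl _ \<Rightarrow> 1 / sqrt (real CARD('m)) | Inr _ \<Rightarrow> 0)"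

definition I2 :: "real ^ ('m::finite + 'n::finite)" where
  "I2 = (\<chi> k. case k of Inl _ \<Rightarrow> 0 | Inr _ \<Rightarrow> 1 / sqrt (real CARD('n)))"

definition L_perp :: "(real ^ ('m::finite + 'n::finite)) set" where
  "L_perp = orthogonal_comp (span {I1, I2})"

definition omega0 :: "nat \<Rightarrow> nat \<Rightarrow> real" where
  "omega0 n1 n2 = arccos (sqrt (real n2 / real (n1 + n2)))"

definition L_dir :: "real \<Rightarrow> real ^ ('m::finite + 'n::finite)" where
  "L_dir \<omega> = cos (\<omega> - omega0 CARD('m) CARD('n)) *\<^sub>R I1 +
             sin (\<omega> - omega0 CARD('m) CARD('n)) *\<^sub>R I2"

definition student_t_density :: "real \<Rightarrow> real \<Rightarrow> real" where
  "student_t_density \<nu> x =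
     Gamma ((\<nu> + 1) / 2) / (sqrt (\<nu> * pi) * Gamma (\<nu> / 2)) *
     (1 + x\<^sup>2 / \<nu>) powr (- ((\<nu> + 1) / 2))"

definition student_t_tail :: "real \<Rightarrow> real \<Rightarrow> real" where
  "student_t_tail \<nu> u =
     measure (density lborel (\<lambda>x. ennreal (student_t_density \<nu> x))) {u<..}"

definition C_const :: "nat \<Rightarrow> nat \<Rightarrow> real \<Rightarrow> real \<Rightarrow> real" where
  "C_const n1 n2 \<alpha> \<beta> = (let n = real (n1 + n2) in
     2 * pi powr ((n - 1) / 2) *
     ((real n1 - 1) / \<alpha>) powr ((real n1 - 1) / 2) *
     ((real n2 - 1) / \<beta>) powr ((real n2 - 1) / 2) *
     (1 / real n1 + 1 / real n2) powr ((n - 2) / 2) /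
     (Gamma ((n - 1) / 2) * (n - 2) powr ((n - 2) / 2)))"

text \<open>Valued in \<open>[0, \<infinity>]\<close>, so that finiteness of the integral is a genuine assertion.\<close>

definition K_const ::
    "real \<Rightarrow> real \<Rightarrow> (real ^ ('m::finite + 'n::finite) \<Rightarrow> real) \<Rightarrow> ennreal" where
  "K_const \<alpha> \<beta> g = (let n = CARD('m) + CARD('n) in
     ennreal (C_const CARD('m) CARD('n) \<alpha> \<beta>) *
     (\<integral>\<^sup>+\<omega>\<in>{- pi / 2..pi / 2}. ennreal (cos \<omega> ^ (n - 2)) *
        (\<integral>\<^sup>+r\<in>{0..}. ennreal (r ^ (n - 1)) * ennreal (g (r *\<^sub>R L_dir \<omega>)) \<partial>lborel) \<partial>lborel))"

end

theory Submission
  imports Defs "HOL-Real_Asymp.Real_Asymp"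
begin

text \<open>
  Write \<open>x = y + z\<close> with \<open>y = r L_dir \<omega> \<in> L\<close> and \<open>z \<in> L_perp\<close>. The numerator of \<open>T\<close> is
  \<open>c r cos \<omega>\<close> with \<open>c\<^sup>2 = 1/n\<^sub>1 + 1/n\<^sub>2\<close>, while the denominator is the square root of a quadratic
  form \<open>Q(z)\<close>. After the substitution \<open>z = (r cos \<omega> / u) \<zeta>\<close> the event \<open>T > u\<close> becomes
  \<open>0 < Q(\<zeta>) < c\<^sup>2\<close>, which no longer depends on \<open>u\<close>, and the Jacobian contributes
  \<open>(r cos \<omega> / u)\<^bsup>n-2\<^esup>\<close>. Hence \<open>u\<^bsup>n-2\<^esup> P(T > u)\<close> is the integral of
  \<open>r\<^bsup>n-1\<^esup> cos\<^bsup>n-2\<^esup>(\<omega>) g(r (L_dir \<omega> + cos \<omega> \<zeta> / u))\<close>, and dominated convergence yields the volume of an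
  ellipsoid times the integral in \<open>K_g\<close>. The tail \<open>t\<^bsub>n-2\<^esub>(u)\<close> decays like a constant times
  \<open>u\<^bsup>-(n-2)\<^esup>\<close>.
\<close>

section \<open>Lebesgue measure on linear subspaces\<close>

text \<open>The angle \<open>omega0\<close> is chosen so that \<open>L_dir (pi / 2)\<close> has all
  coordinates equal; the difference of means vanishes on it and is proportional to the coordinate
  along \<open>L_dir 0\<close>. For \<open>u > 0\<close> only the half-plane with positive numerator
  contributes, hence the range of \<omega>.

  The obstacle is to pass to the limit under an integral over an unbounded plane. The admissible
  \<zeta> form a bounded set and 0 <= cos \<omega> <= 1, so the perturbation cos \<omega> \<zeta> /
  u has norm below \<epsilon> for all large \<open>u\<close>; the supremum in the integrability
  hypothesis is therefore the dominating function. Continuity of \<open>g\<close> gives the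
  pointwise limit.

  The limit is taken in Cartesian coordinates a = r cos \<omega>, b = r sin \<omega>, where the
  Jacobian is a power of \<open>a\<close> alone; polar coordinates only translate the hypothesis and
  \<open>K_const\<close>. The constant \<open>C_const\<close> is the volume of the ellipsoid divided
  by the limit of u^(n-2) t_(n-2)(u): its semi-axes c sqrt((n1-1)/\<alpha>) and c
  sqrt((n2-1)/\<beta>) yield the powers, the ball volume and the Student density the Gamma
  factors.\<close>

text \<open>Lebesgue measure on \<open>span B\<close>, regarded as a measure on the ambient space: there is no type
  of dimension \<open>n - 2\<close> that could carry the orthogonal complement of \<open>L\<close>.\<close>

definition span_lborel :: "'a::euclidean_space set \<Rightarrow> 'a measure" where
  "span_lborel B = distr (Pi\<^sub>M B (\<lambda>_. lborel)) borel (\<lambda>f. \<Sum>b\<in>B. f b *\<^sub>R b)"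

lemma sets_span_lborel [simp, measurable_cong]: "sets (span_lborel B) = sets borel"
  by (simp add: span_lborel_def)

lemma space_span_lborel [simp]: "space (span_lborel B) = UNIV"
  by (simp add: span_lborel_def)

lemma nn_integral_span_lborel:
  assumes [measurable]: "f \<in> borel_measurable borel"
  shows "(\<integral>\<^sup>+z. f z \<partial>span_lborel B) = (\<integral>\<^sup>+h. f (\<Sum>b\<in>B. h b *\<^sub>R b) \<partial>Pi\<^sub>M B (\<lambda>_. lborel))"
  unfolding span_lborel_def by (subst nn_integral_distr) auto

text \<open>Coordinates over \<open>B \<union> C\<close> are glued from coordinates over
  \<open>B\<close> and over \<open>C\<close>, so this is Tonelli for the product measure behind
  \<open>span_lborel\<close>. It later separates the two samples.\<close>

lemma nn_integral_span_lborel_union: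
  assumes "finite B" "finite C" "B \<inter> C = {}" and [measurable]: "f \<in> borel_measurable borel"
  shows "(\<integral>\<^sup>+z. f z \<partial>span_lborel (B \<union> C)) = (\<integral>\<^sup>+x. \<integral>\<^sup>+y. f (x + y) \<partial>span_lborel C \<partial>span_lborel B)"
proof -
  interpret product_sigma_finite "\<lambda>_::'a. lborel :: real measure"
    by standard
  interpret C: sigma_finite_measure "Pi\<^sub>M C (\<lambda>_::'a. lborel :: real measure)"
    by (rule sigma_finite) fact
  have [measurable]: "(\<lambda>x. \<integral>\<^sup>+y. f (x + (\<Sum>b\<in>C. y b *\<^sub>R b)) \<partial>Pi\<^sub>M C (\<lambda>_. lborel)) \<in> borel_measurable borel"
    by measurable
  have "(\<integral>\<^sup>+z. f z \<partial>span_lborel (B \<union> C)) = (\<integral>\<^sup>+h. f (\<Sum>b\<in>B \<union> C. h b *\<^sub>R b) \<partial>Pi\<^sub>M (B \<union> C) (\<lambda>_. lborel))"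
    by (rule nn_integral_span_lborel) fact
  also have "\<dots> = (\<integral>\<^sup>+x. \<integral>\<^sup>+y. f (\<Sum>b\<in>B \<union> C. merge B C (x, y) b *\<^sub>R b)
      \<partial>Pi\<^sub>M C (\<lambda>_. lborel) \<partial>Pi\<^sub>M B (\<lambda>_. lborel))"
    by (rule product_nn_integral_fold) (use assms in auto)
  also have "\<dots> = (\<integral>\<^sup>+x. \<integral>\<^sup>+y. f ((\<Sum>b\<in>B. x b *\<^sub>R b) + (\<Sum>b\<in>C. y b *\<^sub>R b))
      \<partial>Pi\<^sub>M C (\<lambda>_. lborel) \<partial>Pi\<^sub>M B (\<lambda>_. lborel))"
  proof -
    have "(\<Sum>b\<in>B \<union> C. merge B C (x, y) b *\<^sub>R b) = (\<Sum>b\<in>B. x b *\<^sub>R b) + (\<Sum>b\<in>C. y b *\<^sub>R b)" for x y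
    proof -
      have "(\<Sum>b\<in>B. merge B C (x, y) b *\<^sub>R b) = (\<Sum>b\<in>B. x b *\<^sub>R b)"
        by (intro sum.cong) (auto simp: merge_def)
      moreover have "(\<Sum>b\<in>C. merge B C (x, y) b *\<^sub>R b) = (\<Sum>b\<in>C. y b *\<^sub>R b)"
        using assms(3) by (intro sum.cong) (auto simp: merge_def)
      ultimately show ?thesis
        by (simp add: sum.union_disjoint assms)
    qed
    then show ?thesis by simp
  qed
  also have "\<dots> = (\<integral>\<^sup>+x. \<integral>\<^sup>+y. f (x + y) \<partial>span_lborel C \<partial>span_lborel B)"
    by (simp add: nn_integral_span_lborel)
  finally show ?thesis .
qed

lemma nn_integral_span_lborel_insert:
  assumes "finite B" "b \<notin> B" and [measurable]: "f \<in> borel_measurable borel"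
  shows "(\<integral>\<^sup>+z. f z \<partial>span_lborel (insert b B)) = (\<integral>\<^sup>+t. \<integral>\<^sup>+z. f (t *\<^sub>R b + z) \<partial>span_lborel B \<partial>lborel)"
proof -
  interpret product_sigma_finite "\<lambda>_::'a. lborel :: real measure"
    by standard
  interpret B: sigma_finite_measure "Pi\<^sub>M B (\<lambda>_::'a. lborel :: real measure)"
    by (rule sigma_finite) fact
  have "(\<Sum>c\<in>insert b B. (x(b := y)) c *\<^sub>R c) = y *\<^sub>R b + (\<Sum>c\<in>B. x c *\<^sub>R c)" for x y
    using assms(1,2) by (auto intro!: sum.cong)
  then show ?thesis
    by (simp add: nn_integral_span_lborel product_nn_integral_insert_rev assms(1,2) del: fun_upd_apply)
qed

lemma nn_integral_span_lborel_empty: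
  assumes [measurable]: "f \<in> borel_measurable borel"
  shows "(\<integral>\<^sup>+z. f z \<partial>span_lborel {}) = f 0"
  by (simp add: nn_integral_span_lborel PiM_empty nn_integral_count_space_finite)

text \<open>The Jacobian is one factor \<open>c\<close> per spanning vector: the induction applies a
  one-dimensional affine substitution to each coordinate. This is the source of the power u^(-(n-2))
  in the tail.\<close>

lemma nn_integral_span_lborel_scale:
  assumes "finite B" "c > 0" and "f \<in> borel_measurable borel"
  shows "(\<integral>\<^sup>+z. f z \<partial>span_lborel B) = ennreal (c ^ card B) * (\<integral>\<^sup>+z. f (c *\<^sub>R z) \<partial>span_lborel B)"
  using assms(1,3)
proof (induction B arbitrary: f rule: finite_induct)
  case empty
  then show ?case by (simp add: nn_integral_span_lborel_empty)
next
  case (insert b B)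
  note [measurable] = insert.prems
  interpret product_sigma_finite "\<lambda>_::'a. lborel :: real measure"
    by standard
  interpret B: sigma_finite_measure "Pi\<^sub>M B (\<lambda>_::'a. lborel :: real measure)"
    by (rule sigma_finite) fact
  \<comment> \<open>For linearly dependent \<open>B\<close> the image measure need not be
    sigma-finite, so measurability of the inner integral is obtained from the product measure over
    coordinates.\<close>
  have [measurable]: "(\<lambda>t. \<integral>\<^sup>+z. h t z \<partial>span_lborel B) \<in> borel_measurable borel"
    if [measurable]: "case_prod h \<in> borel_measurable (borel \<Otimes>\<^sub>M borel)" for h :: "real \<Rightarrow> 'a \<Rightarrow> ennreal"
    by (simp add: nn_integral_span_lborel)
  have "(\<integral>\<^sup>+z. f z \<partial>span_lborel (insert b B)) = (\<integral>\<^sup>+t. \<integral>\<^sup>+z. f (t *\<^sub>R b + z) \<partial>span_lborel B \<partial>lborel)"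
    by (rule nn_integral_span_lborel_insert) (use insert in auto)
  also have "\<dots> = ennreal c * (\<integral>\<^sup>+t. \<integral>\<^sup>+z. f ((c * t) *\<^sub>R b + z) \<partial>span_lborel B \<partial>lborel)"
    using \<open>c > 0\<close>
    by (subst nn_integral_real_affine[where c=c and t=0]) auto
  also have "\<dots> = ennreal c * (\<integral>\<^sup>+t. ennreal (c ^ card B) * (\<integral>\<^sup>+z. f ((c * t) *\<^sub>R b + c *\<^sub>R z) \<partial>span_lborel B) \<partial>lborel)"
    by (subst insert.IH) auto
  also have "\<dots> = ennreal c * (ennreal (c ^ card B) * (\<integral>\<^sup>+t. (\<integral>\<^sup>+z. f (c *\<^sub>R (t *\<^sub>R b + z)) \<partial>span_lborel B) \<partial>lborel))"
    by (subst nn_integral_cmult) (auto simp: scaleR_add_right)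
  also have "\<dots> = ennreal (c ^ card (insert b B)) * (\<integral>\<^sup>+z. f (c *\<^sub>R z) \<partial>span_lborel (insert b B))"
    using insert.hyps \<open>c > 0\<close>
    by (simp add: nn_integral_span_lborel_insert ennreal_mult mult.assoc)
  finally show ?case .
qed

text \<open>Every vector of \<open>span B\<close> is reached by adding multiples of single vectors
  of \<open>B\<close>, and each such step shifts one coordinate, which leaves Lebesgue measure on
  the line invariant.\<close>

lemma nn_integral_span_lborel_translate:
  assumes "finite B" "v \<in> span B" and "f \<in> borel_measurable borel"
  shows "(\<integral>\<^sup>+z. f (v + z) \<partial>span_lborel B) = (\<integral>\<^sup>+z. f z \<partial>span_lborel B)"
  using assms(2,3)
proof (induction v arbitrary: f rule: span_induct_alt)
  case base
  then show ?case by simp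
next
  case (step c b y)
  note [measurable] = step.prems
  define C where "C = B - {b}"
  have C: "B = insert b C" "b \<notin> C" "finite C"
    using step(1) assms(1) by (auto simp: C_def)
  interpret product_sigma_finite "\<lambda>_::'a. lborel :: real measure"
    by standard
  interpret C: sigma_finite_measure "Pi\<^sub>M C (\<lambda>_::'a. lborel :: real measure)"
    by (rule sigma_finite) fact
  have [measurable]: "(\<lambda>t. \<integral>\<^sup>+z. h t z \<partial>span_lborel C) \<in> borel_measurable borel"
    if [measurable]: "case_prod h \<in> borel_measurable (borel \<Otimes>\<^sub>M borel)" for h :: "real \<Rightarrow> 'a \<Rightarrow> ennreal"
    by (simp add: nn_integral_span_lborel)
  have "(\<integral>\<^sup>+z. f (c *\<^sub>R b + y + z) \<partial>span_lborel B) = (\<integral>\<^sup>+z. f (c *\<^sub>R b + z) \<partial>span_lborel B)"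
    using step.IH[of "\<lambda>z. f (c *\<^sub>R b + z)"] by (simp add: add.assoc)
  also have "\<dots> = (\<integral>\<^sup>+t. \<integral>\<^sup>+z. f ((c + t) *\<^sub>R b + z) \<partial>span_lborel C \<partial>lborel)"
    unfolding C(1) by (subst nn_integral_span_lborel_insert) (auto simp: C scaleR_add_left add.assoc)
  also have "\<dots> = (\<integral>\<^sup>+t. \<integral>\<^sup>+z. f (t *\<^sub>R b + z) \<partial>span_lborel C \<partial>lborel)"
    using nn_integral_real_affine[of "\<lambda>t. \<integral>\<^sup>+z. f (t *\<^sub>R b + z) \<partial>span_lborel C" 1 c] by simp
  also have "\<dots> = (\<integral>\<^sup>+z. f z \<partial>span_lborel B)"
    unfolding C(1) by (subst nn_integral_span_lborel_insert) (auto simp: C)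
  finally show ?case .
qed

section \<open>Orthonormal spanning sets and the identification with \<open>lborel\<close>\<close>

definition orthonormal :: "'a::real_inner set \<Rightarrow> bool" where
  "orthonormal B \<longleftrightarrow> pairwise orthogonal B \<and> (\<forall>b\<in>B. norm b = 1)"

lemma orthonormal_inner:
  "orthonormal B \<Longrightarrow> b \<in> B \<Longrightarrow> c \<in> B \<Longrightarrow> b \<bullet> c = (if b = c then 1 else 0)"
  by (auto simp: orthonormal_def pairwise_def orthogonal_def norm_eq_1)

lemma orthonormal_finite:
  fixes B :: "'a::euclidean_space set"
  shows "orthonormal B \<Longrightarrow> finite B"
  unfolding orthonormal_def using pairwise_orthogonal_imp_finite by blast

lemma orthonormal_independent:
  fixes B :: "'a::euclidean_space set"
  shows "orthonormal B \<Longrightarrow> independent B"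
  unfolding orthonormal_def by (rule pairwise_orthogonal_independent) auto

lemma norm_orthonormal_sum:
  assumes "orthonormal B" "finite B"
  shows "norm (\<Sum>b\<in>B. h b *\<^sub>R b) = sqrt (\<Sum>b\<in>B. (h b)\<^sup>2)"
proof -
  have "(\<Sum>b\<in>B. h b *\<^sub>R b) \<bullet> (\<Sum>b\<in>B. h b *\<^sub>R b) = (\<Sum>b\<in>B. \<Sum>c\<in>B. h b * h c * (b \<bullet> c))"
    by (simp add: inner_sum_left inner_sum_right sum_distrib_left inner_commute mult_ac)
  also have "\<dots> = (\<Sum>b\<in>B. \<Sum>c\<in>B. if b = c then h b * h c else 0)"
    by (intro sum.cong refl) (auto simp: orthonormal_inner[OF assms(1)])
  also have "\<dots> = (\<Sum>b\<in>B. (h b)\<^sup>2)"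
    using assms(2) by (simp add: power2_eq_square)
  finally show ?thesis by (simp add: norm_eq_sqrt_inner)
qed

text \<open>In coordinates the ball is a Euclidean ball, by \<open>norm_orthonormal_sum\<close>.
  This fixes the normalisation of \<open>span_lborel B\<close>; sigma-finiteness and the comparison
  with \<open>lborel\<close> both rest on it.\<close>

lemma emeasure_span_lborel_cball:
  fixes B :: "'a::euclidean_space set"
  assumes "orthonormal B" "r > 0"
  shows "emeasure (span_lborel B) (cball 0 r) = ennreal (unit_ball_vol (card B) * r ^ card B)"
proof -
  have B: "finite B" by (rule orthonormal_finite) fact
  have "emeasure (span_lborel B) (cball 0 r) = emeasure (Pi\<^sub>M B (\<lambda>_. lborel))
     ({f. sqrt (\<Sum>i\<in>B. (f i)\<^sup>2) \<le> r} \<inter> space (Pi\<^sub>M B (\<lambda>_. lborel)))"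
    unfolding span_lborel_def
    by (subst emeasure_distr) (auto intro!: arg_cong[where f="emeasure _"] simp: norm_orthonormal_sum[OF assms(1) B])
  also have "\<dots> = ennreal (unit_ball_vol (card B) * r ^ card B)"
    by (rule emeasure_cball_aux) fact+
  finally show ?thesis .
qed

lemma sigma_finite_span_lborel:
  fixes B :: "'a::euclidean_space set"
  assumes "orthonormal B"
  shows "sigma_finite_measure (span_lborel B)"
proof
  show "\<exists>A. countable A \<and> A \<subseteq> sets (span_lborel B) \<and> \<Union> A = space (span_lborel B) \<and>
     (\<forall>a\<in>A. emeasure (span_lborel B) a \<noteq> \<infinity>)"
  proof (intro exI[of _ "range (\<lambda>n. cball 0 (real (Suc n)))"] conjI ballI)
    show "\<Union> (range (\<lambda>n. cball (0::'a) (real (Suc n)))) = space (span_lborel B)"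
    proof (auto, goal_cases)
      case (1 x)
      obtain n where "norm x \<le> real n" using real_arch_simple by blast
      then show ?case by (intro exI[of _ n]) auto
    qed
  next
    fix a assume "a \<in> range (\<lambda>n. cball (0::'a) (real (Suc n)))"
    then obtain n where "a = cball 0 (real (Suc n))" by auto
    then show "emeasure (span_lborel B) a \<noteq> \<infinity>"
      using emeasure_span_lborel_cball[OF assms, of "real (Suc n)"] by simp
  qed auto
qed

text \<open>Fubini's theorem turns translation invariance of both measures into
  \<open>\<lambda>(A) \<mu>(S) = \<mu>(- A) \<lambda>(S)\<close>, with \<open>\<lambda>\<close> Lebesgue measure and \<open>\<mu> = span_lborel B\<close>; for the unit ball \<open>A\<close> the
  two factors agree.\<close>

lemma span_lborel_eq_lborel:
  fixes B :: "'a::euclidean_space set"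
  assumes B: "orthonormal B" "span B = UNIV"
  shows "span_lborel B = lborel"
proof (rule measure_eqI)
  fix S assume "S \<in> sets (span_lborel B)"
  then have [measurable]: "S \<in> sets borel" by simp
  interpret S: sigma_finite_measure "span_lborel B"
    by (rule sigma_finite_span_lborel) fact
  interpret pair_sigma_finite lborel "span_lborel B"
    by standard
  let ?A = "cball 0 1 :: 'a set"
  have fB: "finite B" by (rule orthonormal_finite) fact
  have "card B = DIM('a)"
    using dim_eq_card[of B UNIV] orthonormal_independent[OF B(1)] B(2)  by simp
  then have A: "emeasure lborel ?A = emeasure (span_lborel B) ?A"
    using emeasure_span_lborel_cball[OF B(1), of 1] by (simp add: emeasure_cball)
  have trB: "(\<integral>\<^sup>+y. f (x + y) \<partial>span_lborel B) = (\<integral>\<^sup>+y. f y \<partial>span_lborel B)"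
    if "f \<in> borel_measurable borel" for f x
    using nn_integral_span_lborel_translate[OF fB _ that, of x] B(2) by simp
  have trL: "(\<integral>\<^sup>+x. f (x + y) \<partial>lborel) = (\<integral>\<^sup>+x. f x \<partial>lborel)"
    if [measurable]: "f \<in> borel_measurable borel" for f :: "'a \<Rightarrow> ennreal" and y
  proof -
    have "(\<integral>\<^sup>+x. f (y + x) \<partial>lborel) = (\<integral>\<^sup>+x. f x \<partial>distr lborel borel ((+) y))"
      by (subst nn_integral_distr) auto
    then show ?thesis by (simp add: lborel_distr_plus add.commute)
  qed
  define \<phi> \<psi> :: "'a \<Rightarrow> ennreal" where "\<phi> = indicator ?A" and "\<psi> = indicator S"
  have [measurable]: "\<phi> \<in> borel_measurable borel" "\<psi> \<in> borel_measurable borel"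
    by (auto simp: \<phi>_def \<psi>_def borel_measurable_indicator)
  have int: "(\<integral>\<^sup>+x. \<phi> x \<partial>lborel) = emeasure lborel ?A"
    "(\<integral>\<^sup>+x. \<psi> x \<partial>lborel) = emeasure lborel S"
    "(\<integral>\<^sup>+x. \<phi> x \<partial>span_lborel B) = emeasure (span_lborel B) ?A"
    "(\<integral>\<^sup>+x. \<psi> x \<partial>span_lborel B) = emeasure (span_lborel B) S"
    by (simp_all add: \<phi>_def \<psi>_def)
  have "emeasure lborel ?A * emeasure (span_lborel B) S
      = (\<integral>\<^sup>+x. \<integral>\<^sup>+y. \<phi> x * \<psi> (x + y) \<partial>span_lborel B \<partial>lborel)"
    by (simp add: nn_integral_cmult trB nn_integral_multc int)
  also have "\<dots> = (\<integral>\<^sup>+y. \<integral>\<^sup>+x. \<phi> x * \<psi> (x + y) \<partial>lborel \<partial>span_lborel B)"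
    by (rule Fubini'[symmetric]) measurable
  also have "\<dots> = (\<integral>\<^sup>+y. \<integral>\<^sup>+x. \<phi> (x - y) * \<psi> x \<partial>lborel \<partial>span_lborel B)"
  proof (rule nn_integral_cong)
    fix y
    show "(\<integral>\<^sup>+x. \<phi> x * \<psi> (x + y) \<partial>lborel) = (\<integral>\<^sup>+x. \<phi> (x - y) * \<psi> x \<partial>lborel)"
      using trL[of "\<lambda>x. \<phi> (x - y) * \<psi> x" y] by simp
  qed
  also have "\<dots> = (\<integral>\<^sup>+x. \<integral>\<^sup>+y. \<phi> (x - y) * \<psi> x \<partial>span_lborel B \<partial>lborel)"
    by (rule Fubini') measurable
  also have "\<dots> = (\<integral>\<^sup>+x. emeasure (span_lborel B) ?A * \<psi> x \<partial>lborel)"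
  proof (rule nn_integral_cong)
    fix x
    have "(\<integral>\<^sup>+y. \<phi> (x - y) \<partial>span_lborel B) = (\<integral>\<^sup>+y. \<phi> (- y) \<partial>span_lborel B)"
      using trB[of "\<lambda>y. \<phi> (x - y)" x] by simp
    also have "\<dots> = (\<integral>\<^sup>+y. \<phi> y \<partial>span_lborel B)"
      by (intro nn_integral_cong) (simp add: \<phi>_def indicator_def)
    finally show "(\<integral>\<^sup>+y. \<phi> (x - y) * \<psi> x \<partial>span_lborel B)
        = emeasure (span_lborel B) ?A * \<psi> x"
      by (simp add: nn_integral_multc int)
  qed
  also have "\<dots> = emeasure lborel ?A * emeasure lborel S"
    by (simp add: nn_integral_cmult A int)
  finally show "emeasure (span_lborel B) S = emeasure lborel S"
    using less_imp_neq[OF unit_ball_vol_pos, of "real DIM('a)"]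
    by (auto simp: emeasure_cball ennreal_mult_cancel_left)
qed simp

section \<open>Volume of an ellipsoid in a subspace\<close>

lemma nn_integral_span_lborel_cong:
  assumes [measurable]: "f \<in> borel_measurable borel" "g \<in> borel_measurable borel"
    and "\<And>z. z \<in> span B \<Longrightarrow> f z = g z"
  shows "(\<integral>\<^sup>+z. f z \<partial>span_lborel B) = (\<integral>\<^sup>+z. g z \<partial>span_lborel B)"
  unfolding nn_integral_span_lborel[OF assms(1)] nn_integral_span_lborel[OF assms(2)]
  by (intro nn_integral_cong assms(3) span_sum span_scale span_base)

lemma sets_borel_span [measurable]: "span B \<in> sets (borel :: 'a::euclidean_space measure)"
  by (intro borel_closed closed_subspace subspace_span)

text \<open>The annuli \<open>cball 0 s - cball 0 (1 - s)\<close> exhaust the punctured ball in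
  measure as \<open>s\<close> tends to 1 from below; \<open>B \<noteq> {}\<close> makes the centre a
  null set. The origin is removed because a zero denominator is outside the event
  \<open>T > u\<close> for \<open>u > 0\<close>.\<close>

lemma emeasure_span_lborel_punctured_ball:
  fixes B :: "'a::euclidean_space set"
  assumes B: "orthonormal B" "B \<noteq> {}"
  shows "emeasure (span_lborel B) (ball 0 1 - {0}) = ennreal (unit_ball_vol (card B))"
proof (rule antisym)
  let ?M = "span_lborel B" and ?V = "unit_ball_vol (card B)"
  have V: "?V > 0" by simp
  have cb: "emeasure ?M (cball 0 r) = ennreal (?V * r ^ card B)" if "r > 0" for r
    using emeasure_span_lborel_cball[OF B(1) that] .
  have "emeasure ?M (ball 0 1 - {0}) \<le> emeasure ?M (cball 0 1)"
    by (intro emeasure_mono) auto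
  then show "emeasure ?M (ball 0 1 - {0}) \<le> ennreal ?V"
    using cb[of 1] by simp
  have "card B > 0"
    using B orthonormal_finite by (simp add: card_gt_0_iff)
  have ev: "\<forall>\<^sub>F s in at_left 1. 1 / 2 < s \<and> s < (1::real)"
    by (rule eventually_at_leftI[of "1/2"]) auto
  have "((\<lambda>s. ennreal (?V * s ^ card B - ?V * (1 - s) ^ card B)) \<longlongrightarrow> ennreal (?V * 1 ^ card B - ?V * (1 - 1) ^ card B)) (at_left 1)"
    by (intro tendsto_intros)
  moreover have "\<forall>\<^sub>F s in at_left 1. ennreal (?V * s ^ card B - ?V * (1 - s) ^ card B) \<le> emeasure ?M (ball 0 1 - {0})"
    using ev
  proof eventually_elim
    case (elim s)
    have "ennreal (?V * s ^ card B - ?V * (1 - s) ^ card B) = emeasure ?M (cball 0 s) - emeasure ?M (cball 0 (1 - s))"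
      using elim V by (simp add: cb ennreal_minus)
    also have "\<dots> = emeasure ?M (cball 0 s - cball 0 (1 - s))"
      using elim by (intro emeasure_Diff[symmetric]) (auto simp: cb)
    also have "\<dots> \<le> emeasure ?M (ball 0 1 - {0})"
      using elim by (intro emeasure_mono) auto
    finally show ?case .
  qed
  ultimately have "ennreal (?V * 1 ^ card B - ?V * (1 - 1) ^ card B) \<le> emeasure ?M (ball 0 1 - {0})"
    by (intro tendsto_upperbound) auto
  then show "ennreal ?V \<le> emeasure ?M (ball 0 1 - {0})"
    using \<open>card B > 0\<close> by (simp add: power_0_left)
qed

lemma orthonormal_subset: "orthonormal B \<Longrightarrow> C \<subseteq> B \<Longrightarrow> orthonormal C"
  unfolding orthonormal_def by (blast intro: pairwise_subset)

text \<open>Scaling \<open>span B1\<close> by \<open>c / sqrt p\<close> and \<open>span B2\<close>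
  by \<open>c / sqrt q\<close> reduces the ellipsoid to the unit ball; the condition
  \<open>0 < Q z\<close> removes only the origin. \<open>Q\<close> is prescribed on the subspace
  alone because the variance form is degenerate on the whole space.\<close>

lemma emeasure_span_lborel_ellipsoid:
  fixes B1 B2 :: "'a::euclidean_space set"
  assumes B: "orthonormal (B1 \<union> B2)" "B1 \<inter> B2 = {}" "B1 \<union> B2 \<noteq> {}"
    and pos: "p > 0" "q > 0" "c > 0"
    and [measurable]: "Q \<in> borel_measurable borel"
    and Q: "\<And>x y. x \<in> span B1 \<Longrightarrow> y \<in> span B2 \<Longrightarrow> Q (x + y) = p * (norm x)\<^sup>2 + q * (norm y)\<^sup>2"
  shows "emeasure (span_lborel (B1 \<union> B2)) {z\<in>span (B1 \<union> B2). 0 < Q z \<and> Q z < c\<^sup>2} =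
    ennreal ((c / sqrt p) ^ card B1 * (c / sqrt q) ^ card B2 * unit_ball_vol (card (B1 \<union> B2)))"
proof -
  have fin: "finite B1" "finite B2"
    using orthonormal_finite[OF B(1)] by auto
  define s t where "s = c / sqrt p" and "t = c / sqrt q"
  have st: "s > 0" "t > 0" using pos by (auto simp: s_def t_def)
  have st2: "p * s\<^sup>2 = c\<^sup>2" "q * t\<^sup>2 = c\<^sup>2"
    using pos by (auto simp: s_def t_def power_divide)
  define f where "f v = (indicator {0<..<c\<^sup>2} v :: ennreal)" for v
  have [measurable]: "f \<in> borel_measurable borel" by (simp add: f_def[abs_def])
  define \<phi> :: "'a \<Rightarrow> ennreal" where "\<phi> = indicator (ball 0 1 - {0})"
  have [measurable]: "\<phi> \<in> borel_measurable borel"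
    by (simp add: \<phi>_def borel_measurable_indicator)
  interpret B2: sigma_finite_measure "span_lborel B2"
    by (rule sigma_finite_span_lborel) (use B(1) in \<open>auto intro: orthonormal_subset\<close>)
  \<comment> \<open>Orthogonality of the two spans is what lets the squared norms add up to that of
    \<open>x + y\<close> after the scaling.\<close>
  have orth: "x \<bullet> y = 0" if "x \<in> span B1" "y \<in> span B2" for x y
  proof -
    have "orthogonal x b" if "b \<in> B2" for b
    proof -
      have "orthogonal b x"
      proof (rule orthogonal_to_span[OF \<open>x \<in> span B1\<close>])
        fix d assume "d \<in> B1"
        then show "orthogonal b d"
          using B(1,2) that by (auto simp: orthogonal_def orthonormal_inner[OF B(1)])
      qed
      then show ?thesis by (simp add: orthogonal_commute)
    qed
    then show ?thesis using orthogonal_to_span[OF \<open>y \<in> span B2\<close>] by (auto simp: orthogonal_def)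
  qed
  have "emeasure (span_lborel (B1 \<union> B2)) {z\<in>span (B1 \<union> B2). 0 < Q z \<and> Q z < c\<^sup>2}
      = (\<integral>\<^sup>+z. indicator {z\<in>span (B1 \<union> B2). 0 < Q z \<and> Q z < c\<^sup>2} z \<partial>span_lborel (B1 \<union> B2))"
    by (rule nn_integral_indicator[symmetric]) measurable
  also have "\<dots> = (\<integral>\<^sup>+z. f (Q z) \<partial>span_lborel (B1 \<union> B2))"
    by (rule nn_integral_span_lborel_cong) (auto simp: f_def indicator_def)
  also have "\<dots> = (\<integral>\<^sup>+x. \<integral>\<^sup>+y. f (Q (x + y)) \<partial>span_lborel B2 \<partial>span_lborel B1)"
    by (rule nn_integral_span_lborel_union) (use fin B in auto)
  also have "\<dots> = (\<integral>\<^sup>+x. \<integral>\<^sup>+y. f (p * (norm x)\<^sup>2 + q * (norm y)\<^sup>2) \<partial>span_lborel B2 \<partial>span_lborel B1)"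
    by (rule nn_integral_span_lborel_cong[OF _ _ nn_integral_span_lborel_cong]) (auto simp: Q)
  also have "\<dots> = ennreal (s ^ card B1) *
     (\<integral>\<^sup>+x. \<integral>\<^sup>+y. f (c\<^sup>2 * (norm x)\<^sup>2 + q * (norm y)\<^sup>2) \<partial>span_lborel B2 \<partial>span_lborel B1)"
    using st st2 by (subst nn_integral_span_lborel_scale[OF fin(1) st(1)]) (auto simp: power_mult_distrib mult.assoc[symmetric])
  also have "(\<integral>\<^sup>+x. \<integral>\<^sup>+y. f (c\<^sup>2 * (norm x)\<^sup>2 + q * (norm y)\<^sup>2) \<partial>span_lborel B2 \<partial>span_lborel B1)
    = (\<integral>\<^sup>+x. ennreal (t ^ card B2) * (\<integral>\<^sup>+y. f (c\<^sup>2 * (norm x)\<^sup>2 + c\<^sup>2 * (norm y)\<^sup>2) \<partial>span_lborel B2) \<partial>span_lborel B1)"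
    using st st2 by (subst nn_integral_span_lborel_scale[OF fin(2) st(2)]) (auto simp: power_mult_distrib mult.assoc[symmetric])
  also have "\<dots> = ennreal (t ^ card B2) * (\<integral>\<^sup>+x. \<integral>\<^sup>+y. f (c\<^sup>2 * (norm x)\<^sup>2 + c\<^sup>2 * (norm y)\<^sup>2) \<partial>span_lborel B2 \<partial>span_lborel B1)"
    by (rule nn_integral_cmult) auto
  also have "(\<integral>\<^sup>+x. \<integral>\<^sup>+y. f (c\<^sup>2 * (norm x)\<^sup>2 + c\<^sup>2 * (norm y)\<^sup>2) \<partial>span_lborel B2 \<partial>span_lborel B1)
    = (\<integral>\<^sup>+x. \<integral>\<^sup>+y. \<phi> (x + y) \<partial>span_lborel B2 \<partial>span_lborel B1)"
  proof (rule nn_integral_span_lborel_cong[OF _ _ nn_integral_span_lborel_cong])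
    fix x y assume xy: "x \<in> span B1" "y \<in> span B2"
    have "c\<^sup>2 * (norm x)\<^sup>2 + c\<^sup>2 * (norm y)\<^sup>2 = (c * norm (x + y))\<^sup>2"
      using orth[OF xy] by (simp add: power_mult_distrib dot_square_norm[symmetric] inner_add_left inner_add_right inner_commute[of y x] algebra_simps)
    moreover have "(c * norm (x + y))\<^sup>2 < c\<^sup>2 \<longleftrightarrow> norm (x + y) < 1"
      using pos by (simp add: power_mult_distrib power_less_one_iff abs_square_less_1)
    ultimately show "f (c\<^sup>2 * (norm x)\<^sup>2 + c\<^sup>2 * (norm y)\<^sup>2) = \<phi> (x + y)"
      using pos by (auto simp: f_def \<phi>_def indicator_def)
  qed auto
  also have "\<dots> = (\<integral>\<^sup>+z. \<phi> z \<partial>span_lborel (B1 \<union> B2))"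
    by (rule nn_integral_span_lborel_union[symmetric]) (use fin B in auto)
  also have "\<dots> = ennreal (unit_ball_vol (card (B1 \<union> B2)))"
    using emeasure_span_lborel_punctured_ball[OF B(1,3)] by (simp add: \<phi>_def)
  finally show ?thesis
    using st by (simp add: ennreal_mult' s_def t_def mult.assoc)
qed

section \<open>Polar coordinates in a half-plane\<close>

text \<open>The substitution is made on the compact intervals [-n, n], which correspond to
  [-arctan n, arctan n]; monotone convergence on both sides then exhausts the line and the open
  interval.\<close>

lemma nn_integral_tan_substitution:
  fixes f :: "real \<Rightarrow> ennreal"
  assumes [measurable]: "f \<in> borel_measurable borel"
  shows "(\<integral>\<^sup>+t. f t \<partial>lborel) =
    (\<integral>\<^sup>+\<omega>\<in>{-pi/2<..<pi/2}. f (tan \<omega>) * ennreal (1 / (cos \<omega>)\<^sup>2) \<partial>lborel)"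
proof -
  have inc: "indicator {- real n..real n} t \<le> (indicator {- real m..real m} t :: ennreal)"
    if "n \<le> m" for n m t
    using that by (auto simp: indicator_def)
  have inc': "indicator {- arctan (real n)..arctan (real n)} t
      \<le> (indicator {- arctan (real m)..arctan (real m)} t :: ennreal)" if "n \<le> m" for n m t
  proof -
    have "arctan n \<le> arctan m" using that by (simp add: arctan_le_iff)
    then show ?thesis by (auto simp: indicator_def)
  qed
  have "(\<integral>\<^sup>+t. f t \<partial>lborel) = (\<integral>\<^sup>+t. (SUP n. f t * indicator {- real n..real n} t) \<partial>lborel)"
  proof (rule nn_integral_cong)
    fix t
    obtain n where n: "\<bar>t\<bar> \<le> real n" using real_arch_simple by blast
    have "f t = (SUP n. f t * indicator {- real n..real n} t)"
    proof (rule antisym)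
      show "f t \<le> (SUP n. f t * indicator {- real n..real n} t)"
        using n by (intro SUP_upper2[of n]) (auto simp: indicator_def)
    qed (auto intro!: SUP_least simp: indicator_def)
    then show "f t = (SUP n. f t * indicator {- real n..real n} t)" .
  qed
  also have "\<dots> = (SUP n. \<integral>\<^sup>+t. f t * indicator {- real n..real n} t \<partial>lborel)"
    by (intro nn_integral_monotone_convergence_SUP)
       (auto intro!: incseq_SucI le_funI mult_left_mono inc)
  also have "\<dots> = (SUP n. \<integral>\<^sup>+\<omega>. f (tan \<omega>) * ennreal (1 / (cos \<omega>)\<^sup>2) *
      indicator {- arctan (real n)..arctan (real n)} \<omega> \<partial>lborel)"
  proof (rule SUP_cong)
    fix n
    show "(\<integral>\<^sup>+t. f t * indicator {- real n..real n} t \<partial>lborel) =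
      (\<integral>\<^sup>+\<omega>. f (tan \<omega>) * ennreal (1 / (cos \<omega>)\<^sup>2) * indicator {- arctan (real n)..arctan (real n)} \<omega> \<partial>lborel)"
    \<comment> \<open>For \<open>n = 0\<close> both intervals are a single point and both integrals
      vanish; the substitution rule asks for a nondegenerate interval.\<close>
    proof (cases "n = 0")
      case True
      have "AE t in lborel. t \<noteq> (0::real)" by (rule AE_lborel_singleton)
      then have "(\<integral>\<^sup>+t. h t * indicator {0} t \<partial>lborel) = 0" for h :: "real \<Rightarrow> ennreal"
        by (subst nn_integral_cong_AE[where v="\<lambda>_. 0"]) (auto elim!: eventually_mono)
      then show ?thesis using True by simp
    next
      case False
      have cos0: "cos x \<noteq> 0" if "x \<in> {- arctan (real n)..arctan (real n)}" for x
        using that arctan_bounded[of "real n"] by (intro cos_gt_zero_pi[THEN less_imp_neq, symmetric]) auto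
      have "(\<integral>\<^sup>+t. f t * indicator {tan (- arctan (real n))..tan (arctan (real n))} t \<partial>lborel) =
        (\<integral>\<^sup>+\<omega>. f (tan \<omega>) * ennreal (1 / (cos \<omega>)\<^sup>2) * indicator {- arctan (real n)..arctan (real n)} \<omega> \<partial>lborel)"
        using False cos0
        by (intro nn_integral_substitution_aux)
           (auto intro!: derivative_eq_intros continuous_intros simp: divide_inverse)
      then show ?thesis by (simp add: tan_arctan tan_minus)
    qed
  qed simp
  also have "\<dots> = (\<integral>\<^sup>+\<omega>. (SUP n. f (tan \<omega>) * ennreal (1 / (cos \<omega>)\<^sup>2) *
      indicator {- arctan (real n)..arctan (real n)} \<omega>) \<partial>lborel)"
    by (intro nn_integral_monotone_convergence_SUP[symmetric])
       (auto intro!: incseq_SucI le_funI mult_left_mono inc' simp: tan_def)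
  also have "\<dots> = (\<integral>\<^sup>+\<omega>\<in>{-pi/2<..<pi/2}. f (tan \<omega>) * ennreal (1 / (cos \<omega>)\<^sup>2) \<partial>lborel)"
  proof (rule nn_integral_cong)
    fix \<omega> :: real
    have bd: "- (pi / 2) < arctan x" "arctan x < pi / 2" for x
      using arctan_bounded[of x] by auto
    show "(SUP n. f (tan \<omega>) * ennreal (1 / (cos \<omega>)\<^sup>2) * indicator {- arctan (real n)..arctan (real n)} \<omega>)
      = f (tan \<omega>) * ennreal (1 / (cos \<omega>)\<^sup>2) * indicator {-pi/2<..<pi/2} \<omega>" (is "_ = ?R")
    proof (cases "\<omega> \<in> {-pi/2<..<pi/2}")
      case True
      obtain n where n: "\<bar>tan \<omega>\<bar> \<le> real n" using real_arch_simple by blast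
      have "\<omega> = arctan (tan \<omega>)" using True by (simp add: arctan_tan)
      moreover have "arctan (tan \<omega>) \<le> arctan (real n)" "arctan (- real n) \<le> arctan (tan \<omega>)"
        using n by (auto simp: arctan_le_iff)
      ultimately have "\<omega> \<in> {- arctan (real n)..arctan (real n)}"
        by (auto simp: arctan_minus)
      then have "?R \<le> (SUP n. f (tan \<omega>) * ennreal (1 / (cos \<omega>)\<^sup>2) * indicator {- arctan (real n)..arctan (real n)} \<omega>)"
        using True by (intro SUP_upper2[of n]) auto
      moreover have "(SUP n. f (tan \<omega>) * ennreal (1 / (cos \<omega>)\<^sup>2) * indicator {- arctan (real n)..arctan (real n)} \<omega>) \<le> ?R"
        using True by (intro SUP_least) (auto simp: indicator_def)
      ultimately show ?thesis by (rule antisym[rotated])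
    next
      case False
      then have "\<omega> \<notin> {- arctan (real n)..arctan (real n)}" for n
        using bd[of "real n"] by auto
      then show ?thesis using False by simp
    qed
  qed
  finally show ?thesis .
qed

text \<open>Only one-dimensional substitutions are needed: \<open>b = a t\<close>, then \<open>t = tan \<omega>\<close>, then
  \<open>a = r cos \<omega>\<close>.\<close>

lemma nn_integral_polar_half_plane:
  fixes f :: "real \<times> real \<Rightarrow> ennreal"
  assumes [measurable]: "f \<in> borel_measurable borel"
  shows "(\<integral>\<^sup>+a\<in>{0<..}. (\<integral>\<^sup>+b. f (a, b) \<partial>lborel) \<partial>lborel) =
    (\<integral>\<^sup>+\<omega>\<in>{-pi/2..pi/2}. (\<integral>\<^sup>+r\<in>{0..}. ennreal r * f (r * cos \<omega>, r * sin \<omega>) \<partial>lborel) \<partial>lborel)"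
proof -
  have "(\<integral>\<^sup>+a\<in>{0<..}. (\<integral>\<^sup>+b. f (a, b) \<partial>lborel) \<partial>lborel)
      = (\<integral>\<^sup>+a. (\<integral>\<^sup>+t. ennreal a * f (a, a * t) * indicator {0<..} a \<partial>lborel) \<partial>lborel)"
  proof (rule nn_integral_cong)
    fix a :: real
    show "(\<integral>\<^sup>+b. f (a, b) \<partial>lborel) * indicator {0<..} a =
        (\<integral>\<^sup>+t. ennreal a * f (a, a * t) * indicator {0<..} a \<partial>lborel)"
    proof (cases "a > 0")
      case True
      then show ?thesis
        using nn_integral_real_affine[of "\<lambda>b. f (a, b)" a 0]
        by (simp add: nn_integral_cmult)
    qed simp
  qed
  also have "\<dots> = (\<integral>\<^sup>+t. (\<integral>\<^sup>+a. ennreal a * f (a, a * t) * indicator {0<..} a \<partial>lborel) \<partial>lborel)"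
    by (rule lborel_pair.Fubini') measurable
  also have "\<dots> = (\<integral>\<^sup>+\<omega>\<in>{-pi/2<..<pi/2}. (\<integral>\<^sup>+a. ennreal a * f (a, a * tan \<omega>) * indicator {0<..} a \<partial>lborel)
      * ennreal (1 / (cos \<omega>)\<^sup>2) \<partial>lborel)"
    by (rule nn_integral_tan_substitution) measurable
  also have "\<dots> = (\<integral>\<^sup>+\<omega>\<in>{-pi/2..pi/2}. (\<integral>\<^sup>+r\<in>{0..}. ennreal r * f (r * cos \<omega>, r * sin \<omega>) \<partial>lborel) \<partial>lborel)"
  proof (rule nn_integral_cong_AE)
    \<comment> \<open>The tangent substitution lives on the open interval, while the target integral
      runs over the closed one; the two endpoints are null.\<close>
    have "AE \<omega> in lborel. \<omega> \<noteq> - pi / 2" "AE \<omega> in lborel. \<omega> \<noteq> pi / 2"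
      by (rule AE_lborel_singleton)+
    then show "AE \<omega> in lborel. (\<integral>\<^sup>+a. ennreal a * f (a, a * tan \<omega>) * indicator {0<..} a \<partial>lborel)
      * ennreal (1 / (cos \<omega>)\<^sup>2) * indicator {-pi/2<..<pi/2} \<omega> =
      (\<integral>\<^sup>+r\<in>{0..}. ennreal r * f (r * cos \<omega>, r * sin \<omega>) \<partial>lborel) * indicator {-pi/2..pi/2} \<omega>"
    proof eventually_elim
      fix \<omega> :: real assume ne: "\<omega> \<noteq> - pi / 2" "\<omega> \<noteq> pi / 2"
      show "(\<integral>\<^sup>+a. ennreal a * f (a, a * tan \<omega>) * indicator {0<..} a \<partial>lborel)
        * ennreal (1 / (cos \<omega>)\<^sup>2) * indicator {-pi/2<..<pi/2} \<omega> =
        (\<integral>\<^sup>+r\<in>{0..}. ennreal r * f (r * cos \<omega>, r * sin \<omega>) \<partial>lborel) * indicator {-pi/2..pi/2} \<omega>"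
      proof (cases "\<omega> \<in> {-pi/2<..<pi/2}")
        case True
        then have c: "cos \<omega> > 0" by (intro cos_gt_zero_pi) auto
        have [measurable]: "(\<lambda>a. f (a, a * tan \<omega>)) \<in> borel_measurable borel" by measurable
        have "(\<integral>\<^sup>+a. ennreal a * f (a, a * tan \<omega>) * indicator {0<..} a \<partial>lborel)
          = ennreal (cos \<omega>) * (\<integral>\<^sup>+r. ennreal (cos \<omega> * r) * f (cos \<omega> * r, cos \<omega> * r * tan \<omega>)
              * indicator {0<..} (cos \<omega> * r) \<partial>lborel)"
          using c nn_integral_real_affine[of "\<lambda>a. ennreal a * f (a, a * tan \<omega>) * indicator {0<..} a" "cos \<omega>" 0]
          by simp
        also have "(\<integral>\<^sup>+r. ennreal (cos \<omega> * r) * f (cos \<omega> * r, cos \<omega> * r * tan \<omega>)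
              * indicator {0<..} (cos \<omega> * r) \<partial>lborel)
          = (\<integral>\<^sup>+r. ennreal (cos \<omega>) * (ennreal r * f (r * cos \<omega>, r * sin \<omega>) * indicator {0..} r) \<partial>lborel)"
        proof (rule nn_integral_cong)
          fix r :: real
          have s: "cos \<omega> * r * tan \<omega> = r * sin \<omega>" using c by (simp add: tan_def)
          have e: "ennreal (cos \<omega> * r) = ennreal (cos \<omega>) * ennreal r"
            using c by (simp add: ennreal_mult')
          show "ennreal (cos \<omega> * r) * f (cos \<omega> * r, cos \<omega> * r * tan \<omega>)
              * indicator {0<..} (cos \<omega> * r) =
            ennreal (cos \<omega>) * (ennreal r * f (r * cos \<omega>, r * sin \<omega>) * indicator {0..} r)"
            unfolding s e using c
            by (cases "r = 0") (auto simp: indicator_def mult.commute[of "cos \<omega>" r] zero_less_mult_iff mult.assoc)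
        qed
        also have "\<dots> = ennreal (cos \<omega>) * (\<integral>\<^sup>+r\<in>{0..}. ennreal r * f (r * cos \<omega>, r * sin \<omega>) \<partial>lborel)"
          by (rule nn_integral_cmult) measurable
        finally have "(\<integral>\<^sup>+a. ennreal a * f (a, a * tan \<omega>) * indicator {0<..} a \<partial>lborel)
            * ennreal (1 / (cos \<omega>)\<^sup>2)
          = (ennreal (cos \<omega>) * ennreal (cos \<omega>) * ennreal (1 / (cos \<omega>)\<^sup>2)) *
            (\<integral>\<^sup>+r\<in>{0..}. ennreal r * f (r * cos \<omega>, r * sin \<omega>) \<partial>lborel)"
          by (simp add: mult_ac)
        \<comment> \<open>One cosine comes from the differential of a = r cos \<omega>, the other
          from the factor \<open>a\<close> left by b = a t; together they cancel the derivative of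
          the tangent.\<close>
        also have "ennreal (cos \<omega>) * ennreal (cos \<omega>) * ennreal (1 / (cos \<omega>)\<^sup>2) = 1"
          using c by (simp flip: ennreal_mult ennreal_mult'' add: power2_eq_square)
        finally show ?thesis using True by simp
      next
        case False
        then have "\<omega> \<notin> {-pi/2..pi/2}" using ne by auto
        then show ?thesis using False by simp
      qed
    qed
  qed
  finally show ?thesis .
qed

section \<open>The tail of the Student distribution\<close>

text \<open>For x > 0 the density is D x^(-\<nu>-1) times a correction that increases to 1. Beyond
  \<open>u\<close> the correction lies between its value \<open>q u\<close> and 1, so the tail is
  squeezed between two multiples of u^(-\<nu>)/\<nu> whose ratio tends to 1.\<close>

lemma student_t_tail_asymp:
  assumes "\<nu> > 0"
  shows "((\<lambda>u. u powr \<nu> * student_t_tail \<nu> u) \<longlongrightarrow>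
    Gamma ((\<nu> + 1) / 2) / (sqrt (\<nu> * pi) * Gamma (\<nu> / 2)) * \<nu> powr ((\<nu> + 1) / 2) / \<nu>) at_top"
proof -
  define c where "c = Gamma ((\<nu> + 1) / 2) / (sqrt (\<nu> * pi) * Gamma (\<nu> / 2))"
  define D where "D = c * \<nu> powr ((\<nu> + 1) / 2)"
  have c: "c > 0"
    using assms by (simp add: c_def Gamma_real_pos)
  then have D: "D > 0" using assms by (simp add: D_def)
  have dens: "student_t_density \<nu> x = D * (1 + \<nu> / x\<^sup>2) powr (- ((\<nu> + 1) / 2)) * x powr (- \<nu> - 1)"
    if "x > 0" for x
  proof -
    have N: "y / \<nu> powr (- p) = y * \<nu> powr p" for y p
      by (simp add: powr_minus_divide)
    have alg: "c * ((X * Y) * P) = (c * P) * Y * X" for X Y P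
      by simp
    have "1 + x\<^sup>2 / \<nu> = x\<^sup>2 * (1 + \<nu> / x\<^sup>2) / \<nu>"
      using that assms by (simp add: field_simps)
    also have "(\<dots>) powr (- ((\<nu> + 1) / 2)) =
      (x\<^sup>2) powr (- ((\<nu> + 1) / 2)) * (1 + \<nu> / x\<^sup>2) powr (- ((\<nu> + 1) / 2)) / \<nu> powr (- ((\<nu> + 1) / 2))"
      using that assms by (simp add: powr_divide powr_mult)
    also have "(x\<^sup>2) powr (- ((\<nu> + 1) / 2)) = x powr (- \<nu> - 1)"
    proof -
      have "(x\<^sup>2) powr (- ((\<nu> + 1) / 2)) = (x powr 2) powr (- ((\<nu> + 1) / 2))"
        using that by (simp add: powr_numeral)
      also have "\<dots> = x powr (- \<nu> - 1)" by (subst powr_powr, rule arg_cong[where f="(powr) x"]) (simp add: field_simps)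
      finally show ?thesis .
    qed
    finally have "student_t_density \<nu> x = c * (x powr (- \<nu> - 1) *
        (1 + \<nu> / x\<^sup>2) powr (- ((\<nu> + 1) / 2)) / \<nu> powr (- ((\<nu> + 1) / 2)))"
      by (simp only: student_t_density_def c_def)
    then show ?thesis
      by (simp only: N D_def alg)
  qed
  have int: "(\<integral>\<^sup>+x\<in>{u..}. ennreal (E * x powr (- \<nu> - 1)) \<partial>lborel) = ennreal (E * u powr (- \<nu>) / \<nu>)"
    if u: "u > 0" and E: "E \<ge> 0" for u E
  proof -
    have "(\<integral>\<^sup>+x\<in>{u..}. ennreal (E * x powr (- \<nu> - 1)) \<partial>lborel) = ennreal (0 - (- (E * u powr (- \<nu>) / \<nu>)))"
    proof (rule nn_integral_FTC_atLeast)
      show "((\<lambda>x. - (E * x powr (- \<nu>) / \<nu>)) has_real_derivative E * x powr (- \<nu> - 1)) (at x)"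
        if "u \<le> x" for x
        using that u assms by (auto intro!: derivative_eq_intros simp: field_simps)
      show "((\<lambda>x. - (E * x powr (- \<nu>) / \<nu>)) \<longlongrightarrow> 0) at_top"
        using assms by real_asymp
    qed (use E in auto)
    then show ?thesis by simp
  qed
  have tail: "student_t_tail \<nu> u = enn2real (\<integral>\<^sup>+x\<in>{u<..}. ennreal (student_t_density \<nu> x) \<partial>lborel)" for u
    unfolding student_t_tail_def measure_def
    by (subst emeasure_density) (auto simp: student_t_density_def)
  define q where "q u = (1 + \<nu> / u\<^sup>2) powr (- ((\<nu> + 1) / 2))" for u
  have closed: "(\<integral>\<^sup>+x\<in>{u<..}. f x \<partial>lborel) = (\<integral>\<^sup>+x\<in>{u..}. f x \<partial>lborel)"
    for u :: real and f :: "real \<Rightarrow> ennreal"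
    using AE_lborel_singleton[of u]
    by (intro nn_integral_cong_AE) (auto elim!: eventually_mono simp: indicator_def)
  have bounds: "D * q u / \<nu> \<le> u powr \<nu> * student_t_tail \<nu> u" "u powr \<nu> * student_t_tail \<nu> u \<le> D / \<nu>"
    if u: "u > 0" for u
  proof -
    have pp: "u powr \<nu> * (x * u powr (- \<nu>) / \<nu>) = x / \<nu>" for x
      using u by (simp add: powr_minus)
    let ?I = "\<integral>\<^sup>+x\<in>{u..}. ennreal (student_t_density \<nu> x) \<partial>lborel"
    have "?I \<le> (\<integral>\<^sup>+x\<in>{u..}. ennreal (D * x powr (- \<nu> - 1)) \<partial>lborel)"
    proof (rule nn_integral_mono)
      fix x :: real
      have "student_t_density \<nu> x \<le> D * x powr (- \<nu> - 1)" if "x \<ge> u"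
      proof -
        have "(1 + \<nu> / x\<^sup>2) powr (- ((\<nu> + 1) / 2)) \<le> 1 powr (- ((\<nu> + 1) / 2))"
          using assms by (intro powr_mono2') auto
        then show ?thesis using that u D by (simp add: dens mult_left_le_one_le mult_right_mono)
      qed
      then show "ennreal (student_t_density \<nu> x) * indicator {u..} x
          \<le> ennreal (D * x powr (- \<nu> - 1)) * indicator {u..} x"
        by (auto simp: indicator_def intro!: ennreal_leI)
    qed
    also have "\<dots> = ennreal (D * u powr (- \<nu>) / \<nu>)" using u D by (intro int) auto
    finally have upper: "?I \<le> ennreal (D * u powr (- \<nu>) / \<nu>)" .
    have "ennreal (D * q u * u powr (- \<nu>) / \<nu>) = (\<integral>\<^sup>+x\<in>{u..}. ennreal (D * q u * x powr (- \<nu> - 1)) \<partial>lborel)"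
      using u D by (intro int[symmetric]) (auto simp: q_def)
    also have "\<dots> \<le> ?I"
    proof (rule nn_integral_mono)
      fix x :: real
      have "D * q u * x powr (- \<nu> - 1) \<le> student_t_density \<nu> x" if "x \<ge> u"
      proof -
        have "q u \<le> q x"
          unfolding q_def using assms u that
          by (intro powr_mono2') (auto intro!: divide_left_mono add_pos_pos power_mono)
        then show ?thesis using that u D by (simp add: dens q_def mult_right_mono)
      qed
      then show "ennreal (D * q u * x powr (- \<nu> - 1)) * indicator {u..} x
          \<le> ennreal (student_t_density \<nu> x) * indicator {u..} x"
        by (auto simp: indicator_def intro!: ennreal_leI)
    qed
    finally have lower: "ennreal (D * q u * u powr (- \<nu>) / \<nu>) \<le> ?I" .
    \<comment> \<open>An infinite integral would be collapsed to 0 by \<open>enn2real\<close>, so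
      the lower bound depends on finiteness.\<close>
    have fin: "?I < \<infinity>" using upper by (rule order.strict_trans1) simp
    have "student_t_tail \<nu> u \<le> D * u powr (- \<nu>) / \<nu>"
      unfolding tail closed using upper D assms by (intro enn2real_leI) auto
    then have "u powr \<nu> * student_t_tail \<nu> u \<le> u powr \<nu> * (D * u powr (- \<nu>) / \<nu>)"
      by (intro mult_left_mono) auto
    then show "u powr \<nu> * student_t_tail \<nu> u \<le> D / \<nu>"
      by (simp only: pp)
    have "D * q u * u powr (- \<nu>) / \<nu> \<le> student_t_tail \<nu> u"
      unfolding tail closed using lower D assms fin
      by (subst ennreal_le_iff[symmetric]) (auto)
    then have "u powr \<nu> * (D * q u * u powr (- \<nu>) / \<nu>) \<le> u powr \<nu> * student_t_tail \<nu> u"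
      by (intro mult_left_mono) auto
    then show "D * q u / \<nu> \<le> u powr \<nu> * student_t_tail \<nu> u"
      by (simp only: pp)
  qed
  have "((\<lambda>u. D * q u / \<nu>) \<longlongrightarrow> D * 1 / \<nu>) at_top"
  proof (intro tendsto_intros)
    have "((\<lambda>u. 1 + \<nu> / u\<^sup>2) \<longlongrightarrow> 1) at_top" by real_asymp
    then have "((\<lambda>u. (1 + \<nu> / u\<^sup>2) powr (- ((\<nu> + 1) / 2))) \<longlongrightarrow> 1 powr (- ((\<nu> + 1) / 2))) at_top"
      by (intro tendsto_intros) auto
    then show "(q \<longlongrightarrow> 1) at_top" by (simp add: q_def[abs_def])
  qed (use assms in auto)
  then have lim: "((\<lambda>u. D * q u / \<nu>) \<longlongrightarrow> D / \<nu>) at_top" by simp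
  have "((\<lambda>u. u powr \<nu> * student_t_tail \<nu> u) \<longlongrightarrow> D / \<nu>) at_top"
  proof (rule tendsto_sandwich[OF _ _ lim tendsto_const])
    show "\<forall>\<^sub>F u in at_top. D * q u / \<nu> \<le> u powr \<nu> * student_t_tail \<nu> u"
      using eventually_gt_at_top[of "0::real"] by eventually_elim (rule bounds)
    show "\<forall>\<^sub>F u in at_top. u powr \<nu> * student_t_tail \<nu> u \<le> D / \<nu>"
      using eventually_gt_at_top[of "0::real"] by eventually_elim (rule bounds)
  qed
  then show ?thesis by (simp add: D_def c_def)
qed

text \<open>This is where \<open>C_const\<close> comes from: times the leading coefficient of the
  Student tail it is the volume of an ellipsoid whose two semi-axes occur n1 - 1 and n2 - 1 times.
  The factors Gamma((k+1)/2) cancel, and Gamma(k/2 + 1) = (k/2) Gamma(k/2) in the ball volume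
  absorbs the factor 2.\<close>

lemma Student_constant:
  assumes n: "n1 \<ge> 2" "n2 \<ge> 2" "k = n1 + n2 - 2" and pos: "\<alpha> > 0" "\<beta> > 0"
    and c: "c = sqrt (1 / real n1 + 1 / real n2)"
  shows "C_const n1 n2 \<alpha> \<beta> *
      (Gamma ((real k + 1) / 2) / (sqrt (real k * pi) * Gamma (real k / 2)) * real k powr ((real k + 1) / 2) / real k)
    = (c / sqrt (\<alpha> / (real n1 - 1))) ^ (n1 - 1) * (c / sqrt (\<beta> / (real n2 - 1))) ^ (n2 - 1) * unit_ball_vol (real k)"
proof -
  have k: "real (n1 + n2) = real k + 2" "k = (n1 - 1) + (n2 - 1)" "k > 0" using n by auto
  have half: "sqrt x ^ m = x powr (real m / 2)" if "x > 0" for x :: real and m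
    using that by (simp add: powr_half_sqrt[symmetric] powr_powr flip: powr_realpow)
  define a b where "a = (real n1 - 1) / \<alpha>" and "b = (real n2 - 1) / \<beta>"
  have ab: "a > 0" "b > 0" using n pos by (auto simp: a_def b_def)
  define d where "d = 1 / real n1 + 1 / real n2"
  have d: "d > 0" using n by (auto simp: d_def add_pos_pos)
  have e1: "c / sqrt (\<alpha> / (real n1 - 1)) = c * sqrt a" "c / sqrt (\<beta> / (real n2 - 1)) = c * sqrt b"
    by (auto simp: a_def b_def real_sqrt_divide)
  have "c ^ (n1 - 1) * c ^ (n2 - 1) = d powr (real k / 2)"
    using d by (simp add: c d_def[symmetric] k(2) half powr_add add_divide_distrib)
  then have rhs: "(c / sqrt (\<alpha> / (real n1 - 1))) ^ (n1 - 1) * (c / sqrt (\<beta> / (real n2 - 1))) ^ (n2 - 1)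
    = d powr (real k / 2) * a powr ((real n1 - 1) / 2) * b powr ((real n2 - 1) / 2)"
    unfolding e1 power_mult_distrib half[OF ab(1)] half[OF ab(2)] using n by (simp add: mult_ac)
  have g: "Gamma (real k / 2 + 1) = real k / 2 * Gamma (real k / 2)"
    using k(3) by (intro Gamma_plus1) (auto elim!: nonpos_Ints_cases)
  define G H where "G = Gamma (real k / 2)" and "H = Gamma ((real k + 1) / 2)"
  have GH: "G > 0" "H > 0"
    using k(3) by (auto simp: G_def H_def intro!: Gamma_real_pos)
  have "real k powr ((real k + 1) / 2) = real k powr (real k / 2 + 1 / 2)" by (simp add: add_divide_distrib)
  then have kp: "real k powr ((real k + 1) / 2) = real k powr (real k / 2) * sqrt (real k)"
    by (simp add: powr_add powr_half_sqrt)
  have "pi powr ((real k + 1) / 2) = pi powr (real k / 2 + 1 / 2)" by (simp add: add_divide_distrib)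
  then have pp: "pi powr ((real k + 1) / 2) = pi powr (real k / 2) * sqrt pi"
    by (simp add: powr_add powr_half_sqrt)
  have kk: "real k powr (real k / 2) > 0" using k(3) by simp
  have C: "C_const n1 n2 \<alpha> \<beta> = 2 * (pi powr (real k / 2) * sqrt pi) * a powr ((real n1 - 1) / 2)
      * b powr ((real n2 - 1) / 2) * d powr (real k / 2) / (Gamma ((real k + 1) / 2) * real k powr (real k / 2))"
    unfolding C_const_def Let_def k(1) pp[symmetric] a_def b_def d_def by (simp add: add.commute)
  show ?thesis
    unfolding rhs C unit_ball_vol_def g kp real_sqrt_mult G_def[symmetric] H_def[symmetric]
    using GH kk k(3) by (simp add: field_simps)
qed

section \<open>Asymptotics of the tail integral\<close>

text \<open>The index set may be uncountable, so countable suprema do not suffice; instead a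
  supremum of continuous functions is lower semicontinuous, its superlevel sets being unions of open
  sets.\<close>

lemma borel_measurable_SUP_continuous:
  fixes f :: "'i \<Rightarrow> 'a::topological_space \<Rightarrow> 'b::{complete_linorder, linorder_topology, second_countable_topology}"
  assumes "\<And>i. i \<in> I \<Longrightarrow> continuous_on UNIV (f i)"
  shows "(\<lambda>x. SUP i\<in>I. f i x) \<in> borel_measurable borel"
proof (rule borel_measurableI_greater)
  fix y
  have "{x. y < (SUP i\<in>I. f i x)} = (\<Union>i\<in>I. f i -` {y<..})"
    by (auto simp: less_SUP_iff)
  moreover have "open (f i -` {y<..})" if "i \<in> I" for i
    using assms[OF that] by (intro open_vimage) auto
  ultimately show "{x \<in> space borel. y < (SUP i\<in>I. f i x)} \<in> sets borel"
    by (auto intro!: borel_open)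
qed

text \<open>The analytic core, for an abstract pair: \<open>D\<close> sees only the coordinate along
  \<open>e\<close>, and \<open>Q\<close> only the component in \<open>span B\<close>, where it is
  homogeneous of degree 2. The weight a^(card B) arises because the substitution scales each
  direction of \<open>B\<close> by a/u; the bound \<open>R\<close> on the region
  \<open>Q z < c\<^sup>2\<close> makes domination possible.\<close>

lemma tail_integral_asymp:
  fixes g D Q :: "'a::euclidean_space \<Rightarrow> real" and S :: "'a set"
  assumes on: "orthonormal (insert e (insert e' B))" "e \<noteq> e'" "e \<notin> B" "e' \<notin> B"
    and full: "span (insert e (insert e' B)) = UNIV"
    and g: "continuous_on UNIV g" "\<And>x. g x \<ge> 0"
    and DQm [measurable]: "D \<in> borel_measurable borel" "Q \<in> borel_measurable borel"
    and D: "\<And>a b z. z \<in> span B \<Longrightarrow> D (a *\<^sub>R e + b *\<^sub>R e' + z) = c * a"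
    and Q: "\<And>a b z. z \<in> span B \<Longrightarrow> Q (a *\<^sub>R e + b *\<^sub>R e' + z) = Q z"
    and Q_scale: "\<And>s z. z \<in> span B \<Longrightarrow> Q (s *\<^sub>R z) = s\<^sup>2 * Q z"
    and Q_nonneg: "\<And>z. z \<in> span B \<Longrightarrow> Q z \<ge> 0"
    and R: "\<And>z. z \<in> span B \<Longrightarrow> Q z < c\<^sup>2 \<Longrightarrow> norm z \<le> R"
    and c: "c > 0" and eps: "\<epsilon> > 0"
    and S: "\<And>z. z \<in> span B \<Longrightarrow> norm z < \<epsilon> \<Longrightarrow> z \<in> S"
    and int: "(\<integral>\<^sup>+a\<in>{0<..}. (\<integral>\<^sup>+b. ennreal (a ^ card B) *
        (SUP \<xi>\<in>S. ennreal (g (a *\<^sub>R e + b *\<^sub>R e' + norm (a *\<^sub>R e + b *\<^sub>R e') *\<^sub>R \<xi>))) \<partial>lborel) \<partial>lborel) < \<infinity>"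
  shows "((\<lambda>u. ennreal (u ^ card B) * (\<integral>\<^sup>+x. ennreal (g x) * indicator {x. D x / sqrt (Q x) > u} x \<partial>lborel))
    \<longlongrightarrow> emeasure (span_lborel B) {z\<in>span B. 0 < Q z \<and> Q z < c\<^sup>2} *
      (\<integral>\<^sup>+a\<in>{0<..}. (\<integral>\<^sup>+b. ennreal (a ^ card B) * ennreal (g (a *\<^sub>R e + b *\<^sub>R e')) \<partial>lborel) \<partial>lborel)) at_top"
proof -
  let ?k = "card B" and ?\<Lambda> = "span_lborel B"
  let ?P = "lborel \<Otimes>\<^sub>M (lborel \<Otimes>\<^sub>M ?\<Lambda>) :: (real \<times> real \<times> 'a) measure"
  define E where "E = {z\<in>span B. 0 < Q z \<and> Q z < c\<^sup>2}"
  have oB: "orthonormal B" "orthonormal (insert e' B)"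
    using on(1) by (auto intro: orthonormal_subset)
  have fB: "finite B" by (rule orthonormal_finite) fact
  interpret L: sigma_finite_measure ?\<Lambda> by (rule sigma_finite_span_lborel) fact
  interpret L': sigma_finite_measure "span_lborel (insert e' B)" by (rule sigma_finite_span_lborel) fact
  interpret LL: pair_sigma_finite "lborel :: real measure" ?\<Lambda> ..
  have P: "sigma_finite_measure (lborel \<Otimes>\<^sub>M ?\<Lambda> :: (real \<times> 'a) measure)"
    by (rule sigma_finite_pair_measure) unfold_locales
  have [measurable]: "g \<in> borel_measurable borel"
    using g(1) by (rule borel_measurable_continuous_onI)
  have E [measurable]: "E \<in> sets borel" unfolding E_def by measurable
  define \<phi> :: "'a \<Rightarrow> ennreal" where "\<phi> = indicator E"
  have [measurable]: "\<phi> \<in> borel_measurable borel"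
    by (simp add: \<phi>_def borel_measurable_indicator)
  \<comment> \<open>The ball formula asks for a positive radius, and \<open>R\<close> may be
    0.\<close>
  have "norm z \<le> max R 1" if "z \<in> E" for z
    using R[of z] that by (auto simp: E_def)
  then have "emeasure ?\<Lambda> E \<le> emeasure ?\<Lambda> (cball 0 (max R 1))"
    by (intro emeasure_mono) auto
  also have "\<dots> < \<infinity>"
    by (subst emeasure_span_lborel_cball[OF oB(1)]) auto
  finally have E_fin: "emeasure ?\<Lambda> E < \<infinity>" .
  have split: "(\<integral>\<^sup>+x. F x \<partial>lborel) = (\<integral>\<^sup>+a. \<integral>\<^sup>+b. \<integral>\<^sup>+z. F (a *\<^sub>R e + b *\<^sub>R e' + z) \<partial>?\<Lambda> \<partial>lborel \<partial>lborel)"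
    if [measurable]: "F \<in> borel_measurable borel" for F :: "'a \<Rightarrow> ennreal"
    unfolding span_lborel_eq_lborel[OF on(1) full, symmetric]
    using on fB by (subst nn_integral_span_lborel_insert) (auto simp: nn_integral_span_lborel_insert add.assoc)
  \<comment> \<open>Dominated convergence is applied to a single measure, so the iterated integrals
    are folded into the product \<open>?P\<close>.\<close>
  have prod: "(\<integral>\<^sup>+a. \<integral>\<^sup>+b. \<integral>\<^sup>+z. F (a, b, z) \<partial>?\<Lambda> \<partial>lborel \<partial>lborel) = (\<integral>\<^sup>+p. F p \<partial>?P)"
    if [measurable]: "F \<in> borel_measurable ?P" for F :: "real \<times> real \<times> 'a \<Rightarrow> ennreal"
  proof -
    have "(\<integral>\<^sup>+b. \<integral>\<^sup>+z. F (a, b, z) \<partial>?\<Lambda> \<partial>lborel) = (\<integral>\<^sup>+q. F (a, q) \<partial>(lborel \<Otimes>\<^sub>M ?\<Lambda>))" for a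
      by (rule L.nn_integral_fst) measurable
    then show ?thesis by (simp add: sigma_finite_measure.nn_integral_fst[OF P])
  qed
  \<comment> \<open>\<open>f u\<close> is the integrand after the substitution, \<open>f0\<close>
    its limit, and \<open>w\<close> the majorant valid for all large \<open>u\<close>.\<close>
  define f where "f u p = (case p of (a, b, z) \<Rightarrow>
      ennreal (a ^ ?k) * ennreal (g (a *\<^sub>R e + b *\<^sub>R e' + (a / u) *\<^sub>R z)) * \<phi> z * indicator {0<..} a)"
    for u p
  define f0 where "f0 p = (case p of (a, b, z) \<Rightarrow>
      ennreal (a ^ ?k) * ennreal (g (a *\<^sub>R e + b *\<^sub>R e')) * \<phi> z * indicator {0<..} a)" for p
  \<comment> \<open>The perturbation is measured in units of \<open>norm y\<close>: on a unit
    direction scaled by r >= 0, this is the supremum of the integrability hypothesis.\<close>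
  define h where "h y = (SUP \<xi>\<in>S. ennreal (g (y + norm y *\<^sub>R \<xi>)))" for y
  define w where "w p = (case p of (a, b, z) \<Rightarrow>
      ennreal (a ^ ?k) * h (a *\<^sub>R e + b *\<^sub>R e') * \<phi> z * indicator {0<..} a)" for p
  have [measurable]: "h \<in> borel_measurable borel"
    unfolding h_def
    by (intro borel_measurable_SUP_continuous continuous_on_ennreal
        continuous_on_compose2[OF g(1)] continuous_intros) auto
  have [measurable]: "f u \<in> borel_measurable ?P" "f0 \<in> borel_measurable ?P" "w \<in> borel_measurable ?P" for u
    unfolding f_def f0_def w_def by measurable
  have scaled: "ennreal (u ^ ?k) * (\<integral>\<^sup>+x. ennreal (g x) * indicator {x. D x / sqrt (Q x) > u} x \<partial>lborel)
      = (\<integral>\<^sup>+p. f u p \<partial>?P)" if u: "u > 0" for u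
  proof -
    define A where "A = {x. D x / sqrt (Q x) > u}"
    have "{x\<in>space borel. D x / sqrt (Q x) > u} \<in> sets borel" by measurable
    then have A [measurable]: "A \<in> sets borel" by (simp add: A_def)
    define \<psi> :: "'a \<Rightarrow> ennreal" where "\<psi> = indicator A"
    have [measurable]: "\<psi> \<in> borel_measurable borel"
      by (simp add: \<psi>_def borel_measurable_indicator)
    have "(\<integral>\<^sup>+x. ennreal (g x) * \<psi> x \<partial>lborel)
      = (\<integral>\<^sup>+a. \<integral>\<^sup>+b. \<integral>\<^sup>+z. ennreal (g (a *\<^sub>R e + b *\<^sub>R e' + z)) * \<psi> (a *\<^sub>R e + b *\<^sub>R e' + z) \<partial>?\<Lambda> \<partial>lborel \<partial>lborel)"
      by (rule split) measurable
    then have "ennreal (u ^ ?k) * (\<integral>\<^sup>+x. ennreal (g x) * \<psi> x \<partial>lborel)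
      = (\<integral>\<^sup>+a. \<integral>\<^sup>+b. ennreal (u ^ ?k) * (\<integral>\<^sup>+z. ennreal (g (a *\<^sub>R e + b *\<^sub>R e' + z)) * \<psi> (a *\<^sub>R e + b *\<^sub>R e' + z) \<partial>?\<Lambda>) \<partial>lborel \<partial>lborel)"
      by (simp add: nn_integral_cmult)
    also have "\<dots> = (\<integral>\<^sup>+a. \<integral>\<^sup>+b. \<integral>\<^sup>+z. f u (a, b, z) \<partial>?\<Lambda> \<partial>lborel \<partial>lborel)"
    proof (intro nn_integral_cong)
      fix a b :: real
      let ?y = "a *\<^sub>R e + b *\<^sub>R e'"
      show "ennreal (u ^ ?k) * (\<integral>\<^sup>+z. ennreal (g (?y + z)) * \<psi> (?y + z) \<partial>?\<Lambda>) = (\<integral>\<^sup>+z. f u (a, b, z) \<partial>?\<Lambda>)"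
      proof (cases "a > 0")
        case False
        have "(\<integral>\<^sup>+z. ennreal (g (?y + z)) * \<psi> (?y + z) \<partial>?\<Lambda>) = (\<integral>\<^sup>+z. 0 \<partial>?\<Lambda>)"
        proof (rule nn_integral_span_lborel_cong)
          fix z assume z: "z \<in> span B"
          have "D (?y + z) / sqrt (Q (?y + z)) \<le> 0"
            using False c Q_nonneg[OF z] unfolding D[OF z] Q[OF z]
            by (intro divide_nonpos_nonneg) (auto simp: mult_nonneg_nonpos)
          then show "ennreal (g (?y + z)) * \<psi> (?y + z) = 0"
            using u by (auto simp: \<psi>_def A_def indicator_def)
        qed auto
        then show ?thesis using False by (simp add: f_def)
      next
        case True
        then have au: "a / u > 0" using u by simp
        have "(\<integral>\<^sup>+z. ennreal (g (?y + z)) * \<psi> (?y + z) \<partial>?\<Lambda>) = ennreal ((a / u) ^ ?k) *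
          (\<integral>\<^sup>+z. ennreal (g (?y + (a / u) *\<^sub>R z)) * \<psi> (?y + (a / u) *\<^sub>R z) \<partial>?\<Lambda>)"
          by (rule nn_integral_span_lborel_scale[OF fB au]) measurable
        also have "(\<integral>\<^sup>+z. ennreal (g (?y + (a / u) *\<^sub>R z)) * \<psi> (?y + (a / u) *\<^sub>R z) \<partial>?\<Lambda>)
          = (\<integral>\<^sup>+z. ennreal (g (?y + (a / u) *\<^sub>R z)) * \<phi> z \<partial>?\<Lambda>)"
        proof (rule nn_integral_span_lborel_cong)
          fix z assume z: "z \<in> span B"
          then have z': "(a / u) *\<^sub>R z \<in> span B" by (rule span_scale)
          have "?y + (a / u) *\<^sub>R z \<in> A \<longleftrightarrow> u < c * a / ((a / u) * sqrt (Q z))"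
            unfolding A_def mem_Collect_eq D[OF z'] Q[OF z'] Q_scale[OF z]
            using u True by (simp add: real_sqrt_mult)
          also have "\<dots> \<longleftrightarrow> 0 < Q z \<and> sqrt (Q z) < c"
          \<comment> \<open>Where \<open>Q z = 0\<close> the quotient is 0 by the division
            convention, so the point is outside the event; this is why \<open>E\<close> asks for
            \<open>0 < Q z\<close>.\<close>
          proof (cases "Q z = 0")
            case True
            then show ?thesis using u by simp
          next
            case False
            then have "Q z > 0" using Q_nonneg[OF z] by simp
            then show ?thesis using u True by (simp add: field_simps)
          qed
          also have "\<dots> \<longleftrightarrow> z \<in> E"
            using z c by (simp add: E_def) (metis real_sqrt_less_iff real_sqrt_abs abs_of_pos)
          finally show "ennreal (g (?y + (a / u) *\<^sub>R z)) * \<psi> (?y + (a / u) *\<^sub>R z)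
              = ennreal (g (?y + (a / u) *\<^sub>R z)) * \<phi> z"
            by (simp add: \<psi>_def \<phi>_def indicator_def)
        qed auto
        finally have "ennreal (u ^ ?k) * (\<integral>\<^sup>+z. ennreal (g (?y + z)) * \<psi> (?y + z) \<partial>?\<Lambda>)
          = ennreal (u ^ ?k) * ennreal ((a / u) ^ ?k) * (\<integral>\<^sup>+z. ennreal (g (?y + (a / u) *\<^sub>R z)) * \<phi> z \<partial>?\<Lambda>)"
          by (simp add: mult.assoc)
        also have "ennreal (u ^ ?k) * ennreal ((a / u) ^ ?k) = ennreal (a ^ ?k)"
          using u au True by (subst ennreal_mult[symmetric]) (auto simp: power_divide)
        finally show ?thesis
          using True by (simp add: f_def nn_integral_cmult mult.assoc)
      qed
    qed
    also have "\<dots> = (\<integral>\<^sup>+p. f u p \<partial>?P)" by (rule prod) measurable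
    finally show ?thesis by (simp add: \<psi>_def A_def)
  qed
  have f0: "(\<integral>\<^sup>+p. f0 p \<partial>?P) = emeasure ?\<Lambda> E *
      (\<integral>\<^sup>+a\<in>{0<..}. (\<integral>\<^sup>+b. ennreal (a ^ ?k) * ennreal (g (a *\<^sub>R e + b *\<^sub>R e')) \<partial>lborel) \<partial>lborel)"
  and w: "(\<integral>\<^sup>+p. w p \<partial>?P) = emeasure ?\<Lambda> E *
      (\<integral>\<^sup>+a\<in>{0<..}. (\<integral>\<^sup>+b. ennreal (a ^ ?k) * h (a *\<^sub>R e + b *\<^sub>R e') \<partial>lborel) \<partial>lborel)"
  proof -
    have *: "(\<integral>\<^sup>+p. (case p of (a, b, z) \<Rightarrow> ennreal (a ^ ?k) * H (a *\<^sub>R e + b *\<^sub>R e') * \<phi> z * indicator {0<..} a) \<partial>?P)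
      = emeasure ?\<Lambda> E * (\<integral>\<^sup>+a\<in>{0<..}. (\<integral>\<^sup>+b. ennreal (a ^ ?k) * H (a *\<^sub>R e + b *\<^sub>R e') \<partial>lborel) \<partial>lborel)"
      if [measurable]: "H \<in> borel_measurable borel" for H :: "'a \<Rightarrow> ennreal"
    proof -
      have i: "(\<integral>\<^sup>+z. \<phi> z \<partial>?\<Lambda>) = emeasure ?\<Lambda> E" by (simp add: \<phi>_def)
      have "(\<integral>\<^sup>+b. \<integral>\<^sup>+z. ennreal (a ^ ?k) * H (a *\<^sub>R e + b *\<^sub>R e') * \<phi> z * indicator {0<..} a \<partial>?\<Lambda> \<partial>lborel)
        = emeasure ?\<Lambda> E * ((\<integral>\<^sup>+b. ennreal (a ^ ?k) * H (a *\<^sub>R e + b *\<^sub>R e') \<partial>lborel) * indicator {0<..} a)" for a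
        by (simp add: nn_integral_cmult nn_integral_multc i mult_ac)
      then show ?thesis
        by (subst prod[symmetric]) (auto simp: nn_integral_cmult)
    qed
    show "(\<integral>\<^sup>+p. f0 p \<partial>?P) = emeasure ?\<Lambda> E *
      (\<integral>\<^sup>+a\<in>{0<..}. (\<integral>\<^sup>+b. ennreal (a ^ ?k) * ennreal (g (a *\<^sub>R e + b *\<^sub>R e')) \<partial>lborel) \<partial>lborel)"
      unfolding f0_def by (rule *) measurable
    show "(\<integral>\<^sup>+p. w p \<partial>?P) = emeasure ?\<Lambda> E *
      (\<integral>\<^sup>+a\<in>{0<..}. (\<integral>\<^sup>+b. ennreal (a ^ ?k) * h (a *\<^sub>R e + b *\<^sub>R e') \<partial>lborel) \<partial>lborel)"
      unfolding w_def by (rule *) measurable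
  qed
  have w_fin: "(\<integral>\<^sup>+p. w p \<partial>?P) < \<infinity>"
    unfolding w using E_fin int by (simp add: h_def ennreal_mult_less_top)
  \<comment> \<open>Beyond this threshold R/u is below \<epsilon>; the maximum with 1 keeps
    \<open>u\<close> positive.\<close>
  define U where "U = max 1 (R / \<epsilon> + 1)"
  have U: "u > 0" "R / u < \<epsilon>" if "u \<ge> U" for u
    using that eps by (auto simp: U_def field_simps)
  have fw: "f u p \<le> w p" if u: "u \<ge> U" for u p
  proof (cases p)
    case (fields a b z)
    show ?thesis
    proof (cases "a > 0 \<and> z \<in> E")
      case True
      let ?y = "a *\<^sub>R e + b *\<^sub>R e'"
      have "e \<bullet> e = 1" "e \<bullet> e' = 0"
        using on by (auto simp: orthonormal_inner[OF on(1)])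
      then have "a = e \<bullet> ?y" by (simp add: inner_add_right)
      also have "\<dots> \<le> norm e * norm ?y" by (rule norm_cauchy_schwarz)
      also have "norm e = 1" using \<open>e \<bullet> e = 1\<close> by (simp add: norm_eq_sqrt_inner)
      finally have a: "a \<le> norm ?y" by simp
      \<comment> \<open>Chosen so that \<open>norm ?y\<close> times \<xi> is the shift (a/u) z. As a
        <= \<open>norm ?y\<close> and \<open>norm z\<close> <= R, its norm is at most R/u <
        \<epsilon>, so it is admissible in the supremum.\<close>
      define \<xi> where "\<xi> = (a / (u * norm ?y)) *\<^sub>R z"
      have y: "norm ?y > 0" using a True by linarith
      have "norm \<xi> = (a / norm ?y) * (norm z / u)"
        using True U(1)[OF u] y by (simp add: \<xi>_def)
      also have "\<dots> \<le> 1 * (R / u)"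
        using True U(1)[OF u] y a R[of z] by (intro mult_mono divide_right_mono) (auto simp: E_def)
      also have "\<dots> < \<epsilon>" using U(2)[OF u] by simp
      finally have "\<xi> \<in> S"
        using True by (intro S) (auto simp: E_def \<xi>_def intro: span_scale)
      then have "ennreal (g (?y + norm ?y *\<^sub>R \<xi>)) \<le> h ?y"
        unfolding h_def by (rule SUP_upper)
      moreover have "norm ?y *\<^sub>R \<xi> = (a / u) *\<^sub>R z"
        using y by (simp add: \<xi>_def)
      ultimately show ?thesis
        by (auto simp: f_def w_def fields intro!: mult_left_mono mult_right_mono)
    qed (auto simp: f_def fields \<phi>_def)
  qed
  have f_lim: "(\<lambda>i. f (v i) p) \<longlonglongrightarrow> f0 p" if v: "filterlim v at_top sequentially" for v :: "nat \<Rightarrow> real" and p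
  proof (cases p)
    case (fields a b z)
    let ?y = "a *\<^sub>R e + b *\<^sub>R e'"
    have "(\<lambda>i. a / v i) \<longlonglongrightarrow> 0"
      using v by (intro tendsto_divide_0[OF tendsto_const] filterlim_at_top_imp_at_infinity)
    then have "(\<lambda>i. ?y + (a / v i) *\<^sub>R z) \<longlonglongrightarrow> ?y + 0 *\<^sub>R z"
      by (intro tendsto_intros)
    then have "(\<lambda>i. g (?y + (a / v i) *\<^sub>R z)) \<longlonglongrightarrow> g (?y + 0 *\<^sub>R z)"
      by (rule continuous_on_tendsto_compose[OF g(1)]) auto
    then have "(\<lambda>i. ennreal (a ^ ?k) * ennreal (g (?y + (a / v i) *\<^sub>R z))) \<longlonglongrightarrow> ennreal (a ^ ?k) * ennreal (g ?y)"
      by (intro ennreal_tendsto_cmult tendsto_ennrealI) auto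
    then show ?thesis
      by (cases "z \<in> E"; cases "a > 0") (auto simp: f_def f0_def fields \<phi>_def)
  qed
  \<comment> \<open>The majorant is valid from \<open>U\<close> on, whereas the sequential criterion
    meets arbitrary sequences tending to infinity; clamping at \<open>U\<close> makes it valid for
    every term.\<close>
  have "((\<lambda>u. \<integral>\<^sup>+p. f (max U u) p \<partial>?P) \<longlongrightarrow> (\<integral>\<^sup>+p. f0 p \<partial>?P)) at_top"
  proof (rule tendsto_at_topI_sequentially)
    fix v :: "nat \<Rightarrow> real" assume v: "filterlim v at_top sequentially"
    have v': "filterlim (\<lambda>i. max U (v i)) at_top sequentially"
      by (rule filterlim_at_top_mono[OF v]) auto
    show "(\<lambda>i. \<integral>\<^sup>+p. f (max U (v i)) p \<partial>?P) \<longlonglongrightarrow> (\<integral>\<^sup>+p. f0 p \<partial>?P)"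
      by (rule nn_integral_dominated_convergence[where w=w]) (use w_fin in \<open>auto simp: fw intro!: f_lim v'\<close>)
  qed
  moreover have "\<forall>\<^sub>F u in at_top. (\<integral>\<^sup>+p. f (max U u) p \<partial>?P) =
    ennreal (u ^ ?k) * (\<integral>\<^sup>+x. ennreal (g x) * indicator {x. D x / sqrt (Q x) > u} x \<partial>lborel)"
    using eventually_ge_at_top[of U]
    by eventually_elim (simp add: scaled U max_absorb2)
  ultimately show ?thesis
    unfolding f0 E_def by (rule Lim_transform_eventually)
qed

section \<open>Sample statistics in coordinates adapted to L\<close>

text \<open>Orthogonality to \<open>v\<close> means that the coordinates over \<open>K\<close> sum
  to 0, so \<open>span B\<close> is the space of residuals of the sample indexed by
  \<open>K\<close>. Vectors stay in the full space, with zeros outside \<open>K\<close>, so that the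
  bases of both samples can be united.\<close>

lemma orthonormal_basis_mean_zero:
  fixes K :: "'k::finite set" and v :: "real ^ 'k"
  assumes K: "K \<noteq> {}" and v: "\<And>k. v $ k = (if k \<in> K then 1 / sqrt (card K) else 0)"
  obtains B where "orthonormal (insert v B)" "v \<notin> B" "card B = card K - 1"
    "span (insert v B) = {z. \<forall>k. k \<notin> K \<longrightarrow> z $ k = 0}"
    "\<And>z. z \<in> span B \<Longrightarrow> z \<bullet> v = 0" "\<And>z k. z \<in> span B \<Longrightarrow> k \<notin> K \<Longrightarrow> z $ k = 0"
proof -
  define S :: "(real ^ 'k) set" where "S = {z. \<forall>k. k \<notin> K \<longrightarrow> z $ k = 0}"
  define W where "W = {z\<in>S. z \<bullet> v = 0}"
  have subS: "subspace S" by (auto simp: S_def subspace_def)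
  have "subspace W"
    using subS by (auto simp: W_def subspace_def inner_add_left)
  then obtain B where B: "B \<subseteq> W" "pairwise orthogonal B" "\<And>x. x \<in> B \<Longrightarrow> norm x = 1" "span B = W"
    using orthonormal_basis_subspace by metis
  have cK: "real (card K) > 0" using K by (simp add: card_gt_0_iff)
  have "v \<bullet> v = (\<Sum>k\<in>UNIV. if k \<in> K then 1 / real (card K) else 0)"
    unfolding inner_vec_def v by (intro sum.cong) auto
  also have "\<dots> = 1" using cK K by (simp add: sum.If_cases)
  finally have vv: "v \<bullet> v = 1" .
  have vS: "v \<in> S" by (simp add: S_def v)
  have on: "orthonormal (insert v B)"
    using B vv by (auto simp: orthonormal_def pairwise_insert orthogonal_def W_def inner_commute norm_eq_1)
  have vB: "v \<notin> B" using B(1) vv by (auto simp: W_def)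
  have "span (insert v B) \<subseteq> S"
    using B(1) vS subS by (intro span_minimal) (auto simp: W_def)
  moreover have "z \<in> span (insert v B)" if "z \<in> S" for z
  proof -
    have "z - (z \<bullet> v) *\<^sub>R v \<in> W"
      using that vS subS vv by (auto simp: W_def inner_diff_left subspace_diff subspace_scale)
    then have "z - (z \<bullet> v) *\<^sub>R v \<in> span B" using B(4) by simp
    then show ?thesis by (auto simp: span_insert)
  qed
  ultimately have sp: "span (insert v B) = S" by auto
  have "card (insert v B) = dim S"
    using orthonormal_independent[OF on] dim_span_eq_card_independent sp by metis
  also have "dim S = card K"
    unfolding S_def using dim_substandard_cart[of K, where 'a=real] by (simp add: dim_vec_eq)
  finally have "card B = card K - 1"
    using vB orthonormal_finite[OF on] by simp
  moreover have "z \<bullet> v = 0" "k \<notin> K \<Longrightarrow> z $ k = 0" if "z \<in> span B" for z k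
    using that unfolding B(4) by (auto simp: S_def W_def)
  ultimately show thesis
    using on vB sp unfolding S_def by (intro that[of B])
qed

section \<open>Sample means and variances in terms of \<open>I1\<close>, \<open>I2\<close> and
  residuals\<close>

lemma sum_Inl_Inr: "(\<Sum>k\<in>UNIV. f k) = (\<Sum>i\<in>UNIV. f (Inl i)) + (\<Sum>j\<in>UNIV. f (Inr j))"
  for f :: "'m::finite + 'n::finite \<Rightarrow> real"
  by (simp flip: UNIV_Plus_UNIV add: sum.Plus)

lemma inner_I1: "x \<bullet> I1 = (\<Sum>i\<in>UNIV. x $ Inl i) / sqrt CARD('m)"
  and inner_I2: "x \<bullet> I2 = (\<Sum>j\<in>UNIV. x $ Inr j) / sqrt CARD('n)"
  for x :: "real ^ ('m::finite + 'n::finite)"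
  by (simp_all add: inner_vec_def sum_Inl_Inr I1_def I2_def sum_divide_distrib)

lemma inner_I [simp]:
  "(I1 :: real ^ ('m::finite + 'n::finite)) \<bullet> I1 = 1" "(I2 :: real ^ ('m + 'n)) \<bullet> I2 = 1"
  "(I1 :: real ^ ('m + 'n)) \<bullet> I2 = 0" "(I2 :: real ^ ('m + 'n)) \<bullet> I1 = 0"
  by (simp_all add: inner_I1 inner_I2) (simp_all add: I1_def I2_def real_div_sqrt)

lemma sample_mean_diff:
  "sample_mean (sample1 x) - sample_mean (sample2 x) = x \<bullet> I1 / sqrt CARD('m) - x \<bullet> I2 / sqrt CARD('n)"
  for x :: "real ^ ('m::finite + 'n::finite)"
  by (simp add: inner_I1 inner_I2 sample_mean_def sample1_def sample2_def)

text \<open>The residuals \<open>z\<close> sum to 0, so the mean is exactly the shift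
  \<open>s\<close> and the deviations are the coordinates of \<open>z\<close>.\<close>

lemma sample_var_shift:
  fixes y z :: "real ^ 'k::finite"
  assumes "\<And>i. y $ i = s + z $ i" "(\<Sum>i\<in>UNIV. z $ i) = 0"
  shows "sample_var y = (norm z)\<^sup>2 / (real CARD('k) - 1)"
proof -
  have "sample_mean y = s"
    by (simp add: sample_mean_def assms sum.distrib)
  moreover have "(norm z)\<^sup>2 = (\<Sum>i\<in>UNIV. (z $ i)\<^sup>2)"
    unfolding power2_norm_eq_inner inner_vec_def by (simp add: power2_eq_square)
  ultimately show ?thesis
    by (simp add: sample_var_def assms(1))
qed

text \<open>On the first sample \<open>I1\<close> is constant while \<open>I2\<close> and
  \<open>z2\<close> vanish, so only \<open>z1\<close> spreads the data; it is zero elsewhere, hence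
  its norm is that of its restriction.\<close>

lemma sample_var1_decomp:
  fixes x z1 z2 :: "real ^ ('m::finite + 'n::finite)"
  assumes "x = s *\<^sub>R I1 + t *\<^sub>R I2 + (z1 + z2)"
    and "z1 \<bullet> I1 = 0" "\<And>j. z1 $ Inr j = 0" "\<And>i. z2 $ Inl i = 0"
  shows "sample_var (sample1 x) = (norm z1)\<^sup>2 / (real CARD('m) - 1)"
proof -
  have sum0: "(\<Sum>i\<in>UNIV. z1 $ Inl i) = 0"
    using assms(2) by (simp add: inner_I1)
  have "sample_var (sample1 x) = (norm (sample1 z1))\<^sup>2 / (real CARD('m) - 1)"
    using sum0 by (intro sample_var_shift[where s="s / sqrt CARD('m)"])
      (auto simp: assms(1,4) sample1_def I1_def I2_def)
  also have "(norm (sample1 z1))\<^sup>2 = (norm z1)\<^sup>2"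
    by (simp add: power2_norm_eq_inner inner_vec_def sum_Inl_Inr assms(3) sample1_def)
  finally show ?thesis .
qed

lemma sample_var2_decomp:
  fixes x z1 z2 :: "real ^ ('m::finite + 'n::finite)"
  assumes "x = s *\<^sub>R I1 + t *\<^sub>R I2 + (z1 + z2)"
    and "z2 \<bullet> I2 = 0" "\<And>j. z1 $ Inr j = 0" "\<And>i. z2 $ Inl i = 0"
  shows "sample_var (sample2 x) = (norm z2)\<^sup>2 / (real CARD('n) - 1)"
proof -
  have sum0: "(\<Sum>i\<in>UNIV. z2 $ Inr i) = 0"
    using assms(2) by (simp add: inner_I2)
  have "sample_var (sample2 x) = (norm (sample2 z2))\<^sup>2 / (real CARD('n) - 1)"
    using sum0 by (intro sample_var_shift[where s="t / sqrt CARD('n)"])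
      (auto simp: assms(1,3) sample2_def I1_def I2_def)
  also have "(norm (sample2 z2))\<^sup>2 = (norm z2)\<^sup>2"
    by (simp add: power2_norm_eq_inner inner_vec_def sum_Inl_Inr assms(4) sample2_def)
  finally show ?thesis .
qed

section \<open>Polar directions in the plane \<open>L\<close>\<close>

lemma omega0_cos_sin:
  assumes "n1 > 0" "n2 > 0"
  shows "cos (omega0 n1 n2) = sqrt (real n2 / real (n1 + n2))"
    "sin (omega0 n1 n2) = sqrt (real n1 / real (n1 + n2))"
proof -
  have q: "0 \<le> real n2 / real (n1 + n2)" "real n2 / real (n1 + n2) \<le> 1"
    using assms by auto
  then have "sqrt (real n2 / real (n1 + n2)) \<le> 1" by simp
  moreover have "-1 \<le> sqrt (real n2 / real (n1 + n2))"
    using q by (meson dual_order.trans neg_le_0_iff_le real_sqrt_ge_0_iff zero_le_one)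
  ultimately show "cos (omega0 n1 n2) = sqrt (real n2 / real (n1 + n2))"
    "sin (omega0 n1 n2) = sqrt (real n1 / real (n1 + n2))"
    using assms q unfolding omega0_def by (auto simp: sin_arccos field_simps)
qed

lemma L_dir_polar:
  "r *\<^sub>R (L_dir \<omega> :: real ^ ('m::finite + 'n::finite)) = (r * cos \<omega>) *\<^sub>R L_dir 0 + (r * sin \<omega>) *\<^sub>R L_dir (pi / 2)"
proof -
  have "cos (pi / 2 - x) = sin x" "sin (pi / 2 - x) = cos x" for x :: real
    by (simp_all add: cos_diff sin_diff)
  then show ?thesis
    by (simp add: L_dir_def cos_diff sin_diff algebra_simps)
qed

lemma L_dir_inner [simp]:
  "(L_dir \<omega> :: real ^ ('m::finite + 'n::finite)) \<bullet> L_dir \<omega>' = cos (\<omega> - \<omega>')"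
  using cos_diff[of "\<omega> - omega0 CARD('m) CARD('n)" "\<omega>' - omega0 CARD('m) CARD('n)"]
  by (simp add: L_dir_def inner_add_left inner_add_right)

text \<open>With a = r cos \<omega> the weight a^k splits into r^k and cos(\<omega>)^k, and the
  Jacobian \<open>r\<close> raises the radial power to \<open>Suc k\<close>; for k = n - 2 these are
  the exponents in \<open>K_const\<close>.\<close>

lemma nn_integral_polar_L:
  fixes H :: "real ^ ('m::finite + 'n::finite) \<Rightarrow> ennreal"
  assumes [measurable]: "H \<in> borel_measurable borel"
  shows "(\<integral>\<^sup>+a\<in>{0<..}. (\<integral>\<^sup>+b. ennreal (a ^ k) * H (a *\<^sub>R L_dir 0 + b *\<^sub>R L_dir (pi / 2)) \<partial>lborel) \<partial>lborel)
    = (\<integral>\<^sup>+\<omega>\<in>{- pi / 2..pi / 2}. ennreal (cos \<omega> ^ k) *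
        (\<integral>\<^sup>+r\<in>{0..}. ennreal (r ^ Suc k) * H (r *\<^sub>R L_dir \<omega>) \<partial>lborel) \<partial>lborel)"
proof -
  define f where "f p = ennreal (fst p ^ k) * H (fst p *\<^sub>R L_dir 0 + snd p *\<^sub>R L_dir (pi / 2))" for p
  have "f \<in> borel_measurable (borel \<Otimes>\<^sub>M borel)"
    unfolding f_def[abs_def] by measurable
  then have f: "f \<in> borel_measurable borel" by (simp add: borel_prod)
  have "(\<integral>\<^sup>+a\<in>{0<..}. (\<integral>\<^sup>+b. f (a, b) \<partial>lborel) \<partial>lborel) =
    (\<integral>\<^sup>+\<omega>\<in>{-pi/2..pi/2}. (\<integral>\<^sup>+r\<in>{0..}. ennreal r * f (r * cos \<omega>, r * sin \<omega>) \<partial>lborel) \<partial>lborel)"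
    by (rule nn_integral_polar_half_plane) fact
  also have "\<dots> = (\<integral>\<^sup>+\<omega>\<in>{- pi / 2..pi / 2}. ennreal (cos \<omega> ^ k) *
        (\<integral>\<^sup>+r\<in>{0..}. ennreal (r ^ Suc k) * H (r *\<^sub>R L_dir \<omega>) \<partial>lborel) \<partial>lborel)"
  proof (rule nn_integral_cong)
    fix \<omega> :: real
    show "(\<integral>\<^sup>+r\<in>{0..}. ennreal r * f (r * cos \<omega>, r * sin \<omega>) \<partial>lborel) * indicator {-pi/2..pi/2} \<omega> =
      ennreal (cos \<omega> ^ k) * (\<integral>\<^sup>+r\<in>{0..}. ennreal (r ^ Suc k) * H (r *\<^sub>R L_dir \<omega>) \<partial>lborel)
        * indicator {-pi/2..pi/2} \<omega>"
    proof (cases "\<omega> \<in> {-pi/2..pi/2}")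
      case True
      then have c: "cos \<omega> \<ge> 0" by (intro cos_ge_zero) auto
      have "(\<integral>\<^sup>+r\<in>{0..}. ennreal r * f (r * cos \<omega>, r * sin \<omega>) \<partial>lborel) =
        (\<integral>\<^sup>+r. ennreal (cos \<omega> ^ k) * (ennreal (r ^ Suc k) * H (r *\<^sub>R L_dir \<omega>) * indicator {0..} r) \<partial>lborel)"
      proof (rule nn_integral_cong)
        fix r :: real
        show "ennreal r * f (r * cos \<omega>, r * sin \<omega>) * indicator {0..} r =
          ennreal (cos \<omega> ^ k) * (ennreal (r ^ Suc k) * H (r *\<^sub>R L_dir \<omega>) * indicator {0..} r)"
        proof (cases "r \<ge> 0")
          case True
          have "ennreal r * ennreal ((r * cos \<omega>) ^ k) = ennreal (cos \<omega> ^ k) * ennreal (r ^ Suc k)"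
            using True c by (simp add: power_mult_distrib mult_ac flip: ennreal_mult)
          then show ?thesis
            using True by (simp add: f_def L_dir_polar[of r \<omega>] mult.assoc[symmetric])
        qed simp
      qed
      also have "\<dots> = ennreal (cos \<omega> ^ k) * (\<integral>\<^sup>+r\<in>{0..}. ennreal (r ^ Suc k) * H (r *\<^sub>R L_dir \<omega>) \<partial>lborel)"
        by (rule nn_integral_cmult) measurable
      finally show ?thesis by simp
    qed simp
  qed
  finally show ?thesis by (simp add: f_def)
qed

text \<open>A vanishing integral would force the integrand to be 0 almost everywhere, yet the points
  with a > 0 and positive \<open>g\<close> form a nonempty open set and so contain a ball of
  positive measure.\<close>

lemma half_plane_integral_pos:
  fixes g :: "'a::euclidean_space \<Rightarrow> real"
  assumes g: "continuous_on UNIV g" "\<And>x. g x \<ge> 0"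
    and p: "a0 \<ge> 0" "g (a0 *\<^sub>R e + b0 *\<^sub>R e') > 0"
  shows "(\<integral>\<^sup>+a\<in>{0<..}. (\<integral>\<^sup>+b. ennreal (a ^ k) * ennreal (g (a *\<^sub>R e + b *\<^sub>R e')) \<partial>lborel) \<partial>lborel) > 0"
proof (rule ccontr)
  have [measurable]: "g \<in> borel_measurable borel"
    using g(1) by (rule borel_measurable_continuous_onI)
  let ?G = "\<lambda>p. g (fst p *\<^sub>R e + snd p *\<^sub>R e')"
  let ?F = "\<lambda>p. ennreal (fst p ^ k) * ennreal (?G p) * indicator {0<..} (fst p)"
  assume "\<not> ?thesis"
  then have "0 = (\<integral>\<^sup>+a\<in>{0<..}. (\<integral>\<^sup>+b. ennreal (a ^ k) * ennreal (g (a *\<^sub>R e + b *\<^sub>R e')) \<partial>lborel) \<partial>lborel)"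
    by simp
  also have "\<dots> = (\<integral>\<^sup>+a. \<integral>\<^sup>+b. ?F (a, b) \<partial>lborel \<partial>lborel)"
    by (simp add: nn_integral_multc)
  also have "\<dots> = (\<integral>\<^sup>+p. ?F p \<partial>(lborel \<Otimes>\<^sub>M lborel))"
    by (rule lborel.nn_integral_fst) measurable
  finally have "AE p in lborel \<Otimes>\<^sub>M lborel. ?F p = 0"
    by (subst (asm) eq_commute, subst (asm) nn_integral_0_iff_AE) auto
  then have ae: "AE p in lborel. ?F p = 0" unfolding lborel_prod .
  have cont: "continuous_on UNIV ?G"
    by (intro continuous_on_compose2[OF g(1)] continuous_intros) auto
  define V where "V = {p. ?G p > 0} \<inter> ({0<..} \<times> UNIV)"
  have oG: "open {p. ?G p > 0}"
    using open_Collect_less[OF continuous_on_const cont] .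
  then have "open V" unfolding V_def by (intro open_Int open_Times) auto
  moreover have "V \<noteq> {}"
  proof -
    \<comment> \<open>The given point may lie on the boundary line a = 0; continuity allows moving
      it slightly to the right.\<close>
    have "((\<lambda>a. ?G (a, b0)) \<longlongrightarrow> ?G (a0, b0)) (at_right a0)"
      by (rule continuous_on_tendsto_compose[OF g(1)]) (auto intro!: tendsto_intros)
    then have "\<forall>\<^sub>F a in at_right a0. ?G (a, b0) > 0"
      using p(2) by (intro order_tendstoD) auto
    moreover have "\<forall>\<^sub>F a in at_right a0. a > a0" by (rule eventually_at_right_less)
    ultimately have "\<forall>\<^sub>F a in at_right a0. (a, b0) \<in> V"
      by eventually_elim (use p(1) in \<open>auto simp: V_def\<close>)
    then show ?thesis
      using eventually_happens'[of "at_right a0"] by fastforce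
  qed
  ultimately obtain x r where r: "r > 0" "ball x r \<subseteq> V"
    by (metis ex_in_conv open_contains_ball)
  have "AE p in lborel. p \<notin> V"
    using ae by eventually_elim (auto simp: V_def ennreal_eq_0_iff dest: zero_less_power[where n=k])
  then have "AE p in lborel. p \<notin> ball x r"
    by eventually_elim (use r in auto)
  then have "emeasure lborel (ball x r) = 0"
    by (subst (asm) AE_iff_measurable[OF _ refl]) (auto simp: ball_def)
  moreover have "emeasure lborel (ball x r) = ennreal (unit_ball_vol (real DIM(real \<times> real)) * r ^ DIM(real \<times> real))"
    using r by (intro emeasure_ball) auto
  moreover have "unit_ball_vol (real DIM(real \<times> real)) * r ^ DIM(real \<times> real) > 0"
    using r by (intro mult_pos_pos unit_ball_vol_pos) auto
  ultimately show False by (simp only: ennreal_eq_0_iff)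
qed

text \<open>\<open>B1\<close> and \<open>B2\<close> span the residuals of the two samples, which are
  orthogonal to each other by disjointness of supports; \<open>L_dir 0\<close> and
  \<open>L_dir (pi / 2)\<close> replace \<open>I1\<close> and \<open>I2\<close> as a basis of
  \<open>L\<close>.\<close>

lemma orthonormal_decomposition:
  obtains B1 B2 :: "(real ^ ('m::finite + 'n::finite)) set" where
    "orthonormal (insert (L_dir 0) (insert (L_dir (pi / 2)) (B1 \<union> B2)))"
    "L_dir 0 \<notin> B1 \<union> B2" "L_dir (pi / 2) \<notin> B1 \<union> B2"
    "span (insert (L_dir 0) (insert (L_dir (pi / 2)) (B1 \<union> B2))) = UNIV"
    "B1 \<inter> B2 = {}" "card B1 = CARD('m) - 1" "card B2 = CARD('n) - 1"
    "\<And>z. z \<in> span B1 \<Longrightarrow> z \<bullet> I1 = 0" "\<And>z. z \<in> span B2 \<Longrightarrow> z \<bullet> I2 = 0"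
    "\<And>z j. z \<in> span B1 \<Longrightarrow> z $ Inr j = 0" "\<And>z i. z \<in> span B2 \<Longrightarrow> z $ Inl i = 0"
proof -
  have cards: "card (range (Inl :: 'm \<Rightarrow> 'm + 'n)) = CARD('m)" "card (range (Inr :: 'n \<Rightarrow> 'm + 'n)) = CARD('n)"
    by (simp_all add: card_image)
  have K: "k \<notin> range Inl \<longleftrightarrow> (\<exists>j. k = Inr j)" "k \<notin> range Inr \<longleftrightarrow> (\<exists>i. k = Inl i)" for k :: "'m + 'n"
    by (cases k; auto)+
  obtain B1 where B1: "orthonormal (insert (I1 :: real ^ ('m + 'n)) B1)" "I1 \<notin> B1"
    "card B1 = CARD('m) - 1" "span (insert I1 B1) = {z. \<forall>j. z $ Inr j = 0}"
    "\<And>z. z \<in> span B1 \<Longrightarrow> z \<bullet> I1 = 0" "\<And>z j. z \<in> span B1 \<Longrightarrow> z $ Inr j = 0"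
  proof (rule orthonormal_basis_mean_zero[of "range Inl" I1])
    show "(I1 :: real ^ ('m + 'n)) $ k = (if k \<in> range Inl then 1 / sqrt (card (range (Inl :: 'm \<Rightarrow> 'm + 'n))) else 0)" for k
      by (cases k) (auto simp: I1_def cards)
  next
    fix B assume B: "orthonormal (insert (I1 :: real ^ ('m + 'n)) B)" "I1 \<notin> B"
      "card B = card (range (Inl :: 'm \<Rightarrow> 'm + 'n)) - 1"
      "span (insert I1 B) = {z. \<forall>k. k \<notin> range Inl \<longrightarrow> z $ k = 0}"
      "\<And>z. z \<in> span B \<Longrightarrow> z \<bullet> I1 = 0" "\<And>z k. z \<in> span B \<Longrightarrow> k \<notin> range Inl \<Longrightarrow> z $ k = 0"
    have "z $ Inr j = 0" if "z \<in> span B" for z j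
      using B(6)[OF that, of "Inr j"] by auto
    moreover have "{z :: real ^ ('m + 'n). \<forall>k. k \<notin> range Inl \<longrightarrow> z $ k = 0} = {z. \<forall>j. z $ Inr j = 0}"
      unfolding K by auto
    ultimately show ?thesis using B(1-5) by (intro that[of B]) (simp_all add: cards)
  qed auto
  obtain B2 where B2: "orthonormal (insert (I2 :: real ^ ('m + 'n)) B2)" "I2 \<notin> B2"
    "card B2 = CARD('n) - 1" "span (insert I2 B2) = {z. \<forall>i. z $ Inl i = 0}"
    "\<And>z. z \<in> span B2 \<Longrightarrow> z \<bullet> I2 = 0" "\<And>z i. z \<in> span B2 \<Longrightarrow> z $ Inl i = 0"
  proof (rule orthonormal_basis_mean_zero[of "range Inr" I2])
    show "(I2 :: real ^ ('m + 'n)) $ k = (if k \<in> range Inr then 1 / sqrt (card (range (Inr :: 'n \<Rightarrow> 'm + 'n))) else 0)" for k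
      by (cases k) (auto simp: I2_def cards)
  next
    fix B assume B: "orthonormal (insert (I2 :: real ^ ('m + 'n)) B)" "I2 \<notin> B"
      "card B = card (range (Inr :: 'n \<Rightarrow> 'm + 'n)) - 1"
      "span (insert I2 B) = {z. \<forall>k. k \<notin> range Inr \<longrightarrow> z $ k = 0}"
      "\<And>z. z \<in> span B \<Longrightarrow> z \<bullet> I2 = 0" "\<And>z k. z \<in> span B \<Longrightarrow> k \<notin> range Inr \<Longrightarrow> z $ k = 0"
    have "z $ Inl j = 0" if "z \<in> span B" for z j
      using B(6)[OF that, of "Inl j"] by auto
    moreover have "{z :: real ^ ('m + 'n). \<forall>k. k \<notin> range Inr \<longrightarrow> z $ k = 0} = {z. \<forall>i. z $ Inl i = 0}"
      unfolding K by auto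
    ultimately show ?thesis using B(1-5) by (intro that[of B]) (simp_all add: cards)
  qed auto
  have z1: "x \<bullet> I1 = 0" "x $ Inr j = 0" if "x \<in> B1" for x j
    using B1(5,6) that span_base by blast+
  have z2: "x \<bullet> I2 = 0" "x $ Inl j = 0" if "x \<in> B2" for x j
    using B2(5,6) that span_base by blast+
  have cross: "x \<bullet> I2 = 0" "y \<bullet> I1 = 0" "x \<bullet> y = 0" if "x \<in> B1" "y \<in> B2" for x y
    using z1(2)[OF that(1)] z2(2)[OF that(2)]
    by (simp_all add: inner_I1 inner_I2) (simp add: inner_vec_def sum_Inl_Inr)
  have c1: "x \<bullet> I2 = 0" if "x \<in> B1" for x using z1(2)[OF that] by (simp add: inner_I2)
  have c2: "x \<bullet> I1 = 0" if "x \<in> B2" for x using z2(2)[OF that] by (simp add: inner_I1)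
  have L0: "x \<bullet> L_dir \<omega> = 0" "L_dir \<omega> \<bullet> x = 0" if "x \<in> B1 \<union> B2" for x \<omega>
    using that z1(1) z2(1) c1 c2
    by (auto simp: L_dir_def inner_add_left inner_add_right inner_commute[of I1] inner_commute[of I2])
  have LL: "L_dir \<omega> \<notin> B1 \<union> B2" for \<omega>
    using L0(1)[of "L_dir \<omega>" \<omega>] by auto
  have n: "norm x = 1" if "x \<in> B1 \<union> B2" for x
    using B1(1) B2(1) that by (auto simp: orthonormal_def)
  have same: "x \<bullet> y = 0" if "x \<in> B1 \<and> y \<in> B1 \<or> x \<in> B2 \<and> y \<in> B2" "x \<noteq> y" for x y
    using B1(1) B2(1) that by (auto simp: orthonormal_def pairwise_insert pairwise_def orthogonal_def)
  have "pairwise orthogonal (B1 \<union> B2)"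
    unfolding pairwise_def orthogonal_def
    by (metis Un_iff cross(3) inner_commute same)
  moreover have "orthogonal (L_dir \<omega>) x" "orthogonal x (L_dir \<omega>)" if "x \<in> B1 \<union> B2" for x \<omega>
    using L0[OF that] by (simp_all add: orthogonal_def)
  moreover have "orthogonal (L_dir 0 :: real ^ ('m + 'n)) (L_dir (pi / 2))"
    "orthogonal (L_dir (pi / 2) :: real ^ ('m + 'n)) (L_dir 0)"
    by (simp_all add: orthogonal_def)
  moreover have "norm (L_dir \<omega> :: real ^ ('m + 'n)) = 1" for \<omega>
    by (simp add: norm_eq_1)
  ultimately have on: "orthonormal (insert (L_dir 0) (insert (L_dir (pi / 2)) (B1 \<union> B2)))"
    unfolding orthonormal_def pairwise_insert using n by blast
  let ?S = "insert (L_dir 0) (insert (L_dir (pi / 2)) (B1 \<union> B2)) :: (real ^ ('m + 'n)) set"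
  have sL: "L_dir \<omega> \<in> span ?S" for \<omega>
    using L_dir_polar[of 1 \<omega>, where 'm='m and 'n='n]
    by (simp add: span_add span_scale span_base)
  \<comment> \<open>Rotating back: the two sample directions are themselves values of
    \<open>L_dir\<close>, which puts \<open>I1\<close> and \<open>I2\<close> into the span.\<close>
  have "I1 = (L_dir (omega0 CARD('m) CARD('n)) :: real ^ ('m + 'n))"
    "I2 = (L_dir (omega0 CARD('m) CARD('n) + pi / 2) :: real ^ ('m + 'n))"
    by (simp_all add: L_dir_def)
  then have sI: "I1 \<in> span ?S" "I2 \<in> span ?S" using sL by metis+
  have sp1: "span (insert I1 B1) \<subseteq> span ?S"
    using sI by (intro span_minimal subspace_span) (auto intro: span_base)
  have sp2: "span (insert I2 B2) \<subseteq> span ?S"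
    using sI by (intro span_minimal subspace_span) (auto intro: span_base)
  have "x \<in> span ?S" for x
  proof -
    let ?x1 = "(\<chi> k. case k of Inl i \<Rightarrow> x $ Inl i | Inr j \<Rightarrow> 0) :: real ^ ('m + 'n)"
    let ?x2 = "(\<chi> k. case k of Inl i \<Rightarrow> 0 | Inr j \<Rightarrow> x $ Inr j) :: real ^ ('m + 'n)"
    have "x = ?x1 + ?x2"
      by (auto simp: vec_eq_iff split: sum.split)
    moreover have "?x1 \<in> span ?S" "?x2 \<in> span ?S"
      using sp1 sp2 unfolding B1(4) B2(4) by auto
    ultimately show ?thesis by (metis span_add)
  qed
  then have "span ?S = UNIV" by blast
  moreover have "B1 \<inter> B2 = {}"
    using cross(3) n by fastforce
  ultimately show thesis
    using on LL B1(3,5,6) B2(3,5,6) by (intro that[of B1 B2]) auto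
qed

section \<open>The asymptotic formula for \<open>T_stat\<close>\<close>

theorem theorem3p1:
  fixes M :: "'w measure"
    and X :: "'w \<Rightarrow> real ^ ('m::finite + 'n::finite)"
    and g :: "real ^ ('m + 'n) \<Rightarrow> real"
    and \<alpha> \<beta> \<epsilon> :: real
    and n1 n2 n :: nat
  assumes n1: "n1 = CARD('m)" "n1 \<ge> 2"
    and n2: "n2 = CARD('n)" "n2 \<ge> 2"
    and n: "n = n1 + n2"
    and "\<alpha> > 0" "\<beta> > 0"
    and "prob_space M"
    and g_nonneg: "\<And>x. g x \<ge> 0"
    and g_density: "distributed M lborel X (\<lambda>x. ennreal (g x))"
    and g_cont: "continuous_on UNIV g"
    and g_pos: "\<exists>r\<ge>0. \<exists>\<omega>\<in>{- pi / 2..pi / 2}. g (r *\<^sub>R L_dir \<omega>) > 0"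
    and "\<epsilon> > 0"
    and g_int: "(\<integral>\<^sup>+\<omega>\<in>{- pi / 2..pi / 2}. ennreal (cos \<omega> ^ (n - 2)) *
        (\<integral>\<^sup>+r\<in>{0..}. ennreal (r ^ (n - 1)) *
           (SUP \<xi>\<in>{\<xi>\<in>L_perp. norm \<xi> < \<epsilon>}. ennreal (g (r *\<^sub>R (L_dir \<omega> + \<xi>))))
         \<partial>lborel) \<partial>lborel) < \<infinity>"
  shows "(\<lambda>u. \<P>(w in M. T_stat \<alpha> \<beta> (X w) > u) / student_t_tail (real n - 2) u
            - enn2real (K_const \<alpha> \<beta> g)) \<in> o[at_top](\<lambda>_. 1)
       \<and> 0 < K_const \<alpha> \<beta> g \<and> K_const \<alpha> \<beta> g < \<infinity>"
proof -
  interpret prob_space M by fact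
  define k where "k = n - 2"
  have k: "n - 2 = k" "n - 1 = Suc k" "real n - 2 = real k" "k > 0" "k = n1 + n2 - 2"
    using n n1 n2 by (auto simp: k_def)
  \<comment> \<open>\<open>c\<close> is the norm of I1 / sqrt n1 - I2 / sqrt n2, the vector
    representing the difference of means; that vector is c times \<open>L_dir 0\<close>.\<close>
  define c where "c = sqrt (1 / real n1 + 1 / real n2)"
  have c: "c > 0" using n1(2) by (auto simp: c_def intro!: add_pos_nonneg)
  \<comment> \<open>The weights of the two squared residual norms under the square root in the
    denominator of \<open>T\<close>.\<close>
  define p q where "p = \<alpha> / (real n1 - 1)" and "q = \<beta> / (real n2 - 1)"
  have pq: "p > 0" "q > 0" using n1(2) n2(2) \<open>\<alpha> > 0\<close> \<open>\<beta> > 0\<close> by (auto simp: p_def q_def)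
  define e e' :: "real ^ ('m + 'n)" where "e = L_dir 0" and "e' = L_dir (pi / 2)"
  obtain B1 B2 :: "(real ^ ('m + 'n)) set" where
    on: "orthonormal (insert e (insert e' (B1 \<union> B2)))"
    and notin: "e \<notin> B1 \<union> B2" "e' \<notin> B1 \<union> B2"
    and full: "span (insert e (insert e' (B1 \<union> B2))) = UNIV"
    and disj: "B1 \<inter> B2 = {}" and cards: "card B1 = n1 - 1" "card B2 = n2 - 1"
    and I: "\<And>z. z \<in> span B1 \<Longrightarrow> z \<bullet> I1 = 0" "\<And>z. z \<in> span B2 \<Longrightarrow> z \<bullet> I2 = 0"
    and comp: "\<And>z j. z \<in> span B1 \<Longrightarrow> z $ Inr j = 0" "\<And>z i. z \<in> span B2 \<Longrightarrow> z $ Inl i = 0"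
    unfolding n1(1) n2(1) e_def e'_def by (rule orthonormal_decomposition) blast
  let ?B = "B1 \<union> B2"
  have ne: "e \<noteq> e'"
  proof
    assume "e = e'"
    then have "e \<bullet> e = e \<bullet> e'" by simp
    then show False by (simp add: e_def e'_def)
  qed
  have oB: "orthonormal ?B" by (rule orthonormal_subset[OF on]) auto
  have fB: "finite B1" "finite B2" using orthonormal_finite[OF oB] by auto
  have cB: "card ?B = k"
    using n1(2) n2(2) by (simp add: card_Un_disjoint fB disj cards k(5))
  then have B_ne: "?B \<noteq> {}" using k(4) by auto
  define D where "D x = sample_mean (sample1 x) - sample_mean (sample2 x)" for x :: "real ^ ('m + 'n)"
  define Q where "Q x = \<alpha> * sample_var (sample1 x) + \<beta> * sample_var (sample2 x)" for x :: "real ^ ('m + 'n)"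
  have D_cont: "continuous_on UNIV D"
    unfolding D_def sample_mean_def sample1_def sample2_def by (auto intro!: continuous_intros)
  have Q_cont: "continuous_on UNIV Q"
    unfolding Q_def sample_var_def sample_mean_def sample1_def sample2_def
    using n1 n2 by (auto intro!: continuous_intros)
  note DQ [measurable] = D_cont[THEN borel_measurable_continuous_onI] Q_cont[THEN borel_measurable_continuous_onI]
  have [measurable]: "g \<in> borel_measurable borel"
    using g_cont by (rule borel_measurable_continuous_onI)
  have cs: "cos (omega0 n1 n2) = sqrt (real n2 / real n)" "sin (omega0 n1 n2) = sqrt (real n1 / real n)"
    using omega0_cos_sin[of n1 n2] n n1(2) n2(2) by simp_all
  have eI: "e = cos (omega0 n1 n2) *\<^sub>R I1 + (- sin (omega0 n1 n2)) *\<^sub>R I2"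
    "e' = sin (omega0 n1 n2) *\<^sub>R I1 + cos (omega0 n1 n2) *\<^sub>R I2"
    by (simp_all add: e_def e'_def L_dir_def n1(1) n2(1) cos_diff sin_diff)
  have decomp: "a *\<^sub>R e + b *\<^sub>R e' + z =
      (a * cos (omega0 n1 n2) + b * sin (omega0 n1 n2)) *\<^sub>R I1 +
      (b * cos (omega0 n1 n2) - a * sin (omega0 n1 n2)) *\<^sub>R I2 + z" for a b z
    by (simp add: eI algebra_simps)
  have I_cross: "z \<bullet> I2 = 0" if "z \<in> span B1" for z
    using comp(1)[OF that] by (simp add: inner_I2)
  have I_cross': "z \<bullet> I1 = 0" if "z \<in> span B2" for z
    using comp(2)[OF that] by (simp add: inner_I1)
  have split: "\<exists>x y. z = x + y \<and> x \<in> span B1 \<and> y \<in> span B2" if "z \<in> span ?B" for z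
    using that by (auto simp: span_Un)
  have zI: "z \<bullet> I1 = 0" "z \<bullet> I2 = 0" if "z \<in> span ?B" for z
  proof -
    from split[OF that] obtain x y where "z = x + y" "x \<in> span B1" "y \<in> span B2"
      by auto
    then show "z \<bullet> I1 = 0" "z \<bullet> I2 = 0" using I I_cross I_cross' by (auto simp: inner_add_left)
  qed
  have perp: "z \<in> L_perp" if "z \<in> span ?B" for z
  proof -
    have "orthogonal z y" if "y \<in> span {I1, I2}" for y
      using zI[OF \<open>z \<in> span ?B\<close>] that by (intro orthogonal_to_span[OF that]) (auto simp: orthogonal_def)
    then show ?thesis by (auto simp: L_perp_def orthogonal_comp_def orthogonal_commute)
  qed
  have D: "D (a *\<^sub>R e + b *\<^sub>R e' + z) = c * a" if "z \<in> span ?B" for a b z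
  proof -
    have "D (a *\<^sub>R e + b *\<^sub>R e' + z) =
      a * (cos (omega0 n1 n2) / sqrt n1 + sin (omega0 n1 n2) / sqrt n2)
      + b * (sin (omega0 n1 n2) / sqrt n1 - cos (omega0 n1 n2) / sqrt n2)"
      unfolding D_def sample_mean_diff decomp
      using zI[OF that]
      by (simp add: inner_add_left n1(1) n2(1) add_divide_distrib diff_divide_distrib ring_distribs)
    \<comment> \<open>The choice of \<open>omega0\<close> at work: \<open>e'\<close> has all
      coordinates equal, so moving along it shifts both sample means by the same amount.\<close>
    also have "sin (omega0 n1 n2) / sqrt n1 - cos (omega0 n1 n2) / sqrt n2 = 0"
      using n1(2) n2(2) by (simp add: cs real_sqrt_divide)
    also have "cos (omega0 n1 n2) / sqrt n1 + sin (omega0 n1 n2) / sqrt n2 = c"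
    proof -
      have pos: "real n1 > 0" "real n2 > 0" "real n > 0" using n n1(2) n2(2) by auto
      have "cos (omega0 n1 n2) / sqrt n1 + sin (omega0 n1 n2) / sqrt n2
        = (sqrt n2 * sqrt n2 + sqrt n1 * sqrt n1) / (sqrt n * sqrt n1 * sqrt n2)"
        using pos unfolding cs real_sqrt_divide by (simp add: field_simps)
      also have "\<dots> = sqrt n * sqrt n / (sqrt n * sqrt n1 * sqrt n2)"
        using n by simp
      also have "\<dots> = sqrt n / (sqrt n1 * sqrt n2)"
        using pos unfolding mult.assoc by (subst mult_divide_mult_cancel_left) auto
      also have "\<dots> = c"
        using pos n by (simp add: c_def field_simps flip: real_sqrt_mult real_sqrt_divide)
      finally show ?thesis .
    qed
    finally show ?thesis by simp
  qed
  have Q_decomp: "Q (a *\<^sub>R e + b *\<^sub>R e' + (x + y)) = p * (norm x)\<^sup>2 + q * (norm y)\<^sup>2"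
    if "x \<in> span B1" "y \<in> span B2" for a b x y
    unfolding Q_def decomp p_def q_def
    using sample_var1_decomp[OF refl I(1)[OF that(1)] comp(1)[OF that(1)] comp(2)[OF that(2)]]
      sample_var2_decomp[OF refl I(2)[OF that(2)] comp(1)[OF that(1)] comp(2)[OF that(2)]]
    by (simp add: n1(1) n2(1))
  have Q0: "Q (x + y) = p * (norm x)\<^sup>2 + q * (norm y)\<^sup>2" if "x \<in> span B1" "y \<in> span B2" for x y
    using Q_decomp[OF that, of 0 0] by simp
  have Q: "Q (a *\<^sub>R e + b *\<^sub>R e' + z) = Q z" if "z \<in> span ?B" for a b z
    using split[OF that] Q_decomp Q0 by auto
  have Q_scale: "Q (s *\<^sub>R z) = s\<^sup>2 * Q z" if "z \<in> span ?B" for s z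
  proof -
    from split[OF that] obtain x y where xy: "z = x + y" "x \<in> span B1" "y \<in> span B2" by auto
    show ?thesis
      using Q0[OF span_scale[OF xy(2), of s] span_scale[OF xy(3), of s]] Q0[OF xy(2,3)]
      by (simp add: xy(1) scaleR_add_right power_mult_distrib algebra_simps)
  qed
  have Q_nonneg: "Q z \<ge> 0" if "z \<in> span ?B" for z
    using split[OF that] Q0 pq by auto
  \<comment> \<open>The semi-axes of the ellipsoid are \<open>c / sqrt p\<close> and
    \<open>c / sqrt q\<close>; their sum is a crude but sufficient bound.\<close>
  have R: "norm z \<le> c / sqrt p + c / sqrt q" if "z \<in> span ?B" "Q z < c\<^sup>2" for z
  proof -
    from split[OF that(1)] obtain x y where xy: "z = x + y" "x \<in> span B1" "y \<in> span B2" by auto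
    have *: "norm w \<le> c / sqrt s" if "s * (norm w)\<^sup>2 \<le> c\<^sup>2" "s > 0" for s and w :: "real ^ ('m + 'n)"
    proof (rule power2_le_imp_le)
      show "(norm w)\<^sup>2 \<le> (c / sqrt s)\<^sup>2"
        using that by (simp add: power_divide field_simps)
    qed (use c that in auto)
    have "p * (norm x)\<^sup>2 + q * (norm y)\<^sup>2 < c\<^sup>2" using that(2) Q0[OF xy(2,3)] xy(1) by simp
    moreover have "p * (norm x)\<^sup>2 \<ge> 0" "q * (norm y)\<^sup>2 \<ge> 0" using pq by auto
    ultimately have "p * (norm x)\<^sup>2 \<le> c\<^sup>2" "q * (norm y)\<^sup>2 \<le> c\<^sup>2" by linarith+
    then have "norm x \<le> c / sqrt p" "norm y \<le> c / sqrt q"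
      using pq by (auto intro!: *)
    then show ?thesis unfolding xy(1) by (intro order_trans[OF norm_triangle_ineq]) auto
  qed
  define S :: "(real ^ ('m + 'n)) set" where "S = {\<xi>\<in>L_perp. norm \<xi> < \<epsilon>}"
  define h where "h y = (SUP \<xi>\<in>S. ennreal (g (y + norm y *\<^sub>R \<xi>)))" for y
  have h_meas [measurable]: "h \<in> borel_measurable borel"
    unfolding h_def
    by (intro borel_measurable_SUP_continuous continuous_on_ennreal
        continuous_on_compose2[OF g_cont] continuous_intros) auto
  define J where "J = (\<integral>\<^sup>+a\<in>{0<..}. (\<integral>\<^sup>+b. ennreal (a ^ k) * ennreal (g (a *\<^sub>R e + b *\<^sub>R e')) \<partial>lborel) \<partial>lborel)"
  have h_polar: "h (r *\<^sub>R L_dir \<omega>) = (SUP \<xi>\<in>S. ennreal (g (r *\<^sub>R (L_dir \<omega> + \<xi>))))" if "r \<ge> 0" for r \<omega>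
  proof -
    have "norm (L_dir \<omega> :: real ^ ('m + 'n)) = 1" by (simp add: norm_eq_1)
    then show ?thesis using that by (simp add: h_def scaleR_add_right)
  qed
  \<comment> \<open>The identity of suprema is available for r >= 0; the indicator extends it to all
    \<open>r\<close>, so that it can be rewritten under the integral.\<close>
  have h_ind: "ennreal (r ^ Suc k) * h (r *\<^sub>R L_dir \<omega>) * indicator {0..} r =
      ennreal (r ^ Suc k) * (SUP \<xi>\<in>S. ennreal (g (r *\<^sub>R (L_dir \<omega> + \<xi>)))) * indicator {0..} r" for r \<omega>
    by (cases "r \<ge> 0") (simp_all add: h_polar)
  have "(\<integral>\<^sup>+a\<in>{0<..}. (\<integral>\<^sup>+b. ennreal (a ^ k) * h (a *\<^sub>R e + b *\<^sub>R e') \<partial>lborel) \<partial>lborel)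
    = (\<integral>\<^sup>+\<omega>\<in>{- pi / 2..pi / 2}. ennreal (cos \<omega> ^ k) *
        (\<integral>\<^sup>+r\<in>{0..}. ennreal (r ^ Suc k) * h (r *\<^sub>R L_dir \<omega>) \<partial>lborel) \<partial>lborel)"
    unfolding e_def e'_def by (rule nn_integral_polar_L) measurable
  also have "\<dots> = (\<integral>\<^sup>+\<omega>\<in>{- pi / 2..pi / 2}. ennreal (cos \<omega> ^ (n - 2)) *
        (\<integral>\<^sup>+r\<in>{0..}. ennreal (r ^ (n - 1)) *
           (SUP \<xi>\<in>{\<xi>\<in>L_perp. norm \<xi> < \<epsilon>}. ennreal (g (r *\<^sub>R (L_dir \<omega> + \<xi>))))
         \<partial>lborel) \<partial>lborel)"
    unfolding k(1,2) S_def[symmetric] by (simp only: h_ind)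
  also note g_int
  finally have int: "(\<integral>\<^sup>+a\<in>{0<..}. (\<integral>\<^sup>+b. ennreal (a ^ k) * h (a *\<^sub>R e + b *\<^sub>R e') \<partial>lborel) \<partial>lborel) < \<infinity>" .
  \<comment> \<open>Since the supremum includes \<xi> = 0, \<open>h\<close> dominates
    \<open>g\<close>, and finiteness of \<open>K_const\<close> is inherited from the integrability
    hypothesis.\<close>
  have "0 \<in> S"
    using perp[OF span_zero] \<open>\<epsilon> > 0\<close> by (simp add: S_def)
  have gh: "ennreal (g y) \<le> h y" for y
    unfolding h_def using \<open>0 \<in> S\<close> by (intro SUP_upper2[of 0]) auto
  have "J \<le> (\<integral>\<^sup>+a\<in>{0<..}. (\<integral>\<^sup>+b. ennreal (a ^ k) * h (a *\<^sub>R e + b *\<^sub>R e') \<partial>lborel) \<partial>lborel)"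
    unfolding J_def by (intro nn_integral_mono mult_right_mono mult_left_mono gh) auto
  then have J_fin: "J < \<infinity>" using int by (rule order.strict_trans1)
  obtain r \<omega> where r\<omega>: "r \<ge> 0" "\<omega> \<in> {- pi / 2..pi / 2}" "g (r *\<^sub>R L_dir \<omega>) > 0"
    using g_pos by blast
  have "cos \<omega> \<ge> 0" using r\<omega>(2) by (intro cos_ge_zero) auto
  then have J_pos: "J > 0"
    unfolding J_def using r\<omega> L_dir_polar[of r \<omega>, where 'm='m and 'n='n]
    by (intro half_plane_integral_pos[OF g_cont g_nonneg, of "r * cos \<omega>" e "r * sin \<omega>" e'])
      (auto simp: e_def e'_def)
  have "1 / real n1 + 1 / real n2 > 0"
    using n1(2) n2(2) by (intro add_pos_pos) auto
  then have C_pos: "C_const n1 n2 \<alpha> \<beta> > 0"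
    unfolding C_const_def Let_def using n1(2) n2(2) \<open>\<alpha> > 0\<close> \<open>\<beta> > 0\<close>
    by (intro divide_pos_pos mult_pos_pos Gamma_real_pos) auto
  have K: "K_const \<alpha> \<beta> g = ennreal (C_const n1 n2 \<alpha> \<beta>) * J"
    unfolding K_const_def Let_def n1(1)[symmetric] n2(1)[symmetric] n[symmetric] k(1,2) J_def e_def e'_def
    by (subst nn_integral_polar_L) simp_all
  obtain j where j: "J = ennreal j" "j > 0"
    using J_fin J_pos by (cases J) auto
  have K': "K_const \<alpha> \<beta> g = ennreal (C_const n1 n2 \<alpha> \<beta> * j)"
    using K C_pos j by (simp add: ennreal_mult)
  \<comment> \<open>The limit of u^k times the Student tail. It reappears as a factor of the volume
    below and cancels in the quotient, leaving \<open>C_const\<close>.\<close>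
  define \<tau> where "\<tau> = Gamma ((real k + 1) / 2) / (sqrt (real k * pi) * Gamma (real k / 2)) *
    real k powr ((real k + 1) / 2) / real k"
  have "\<tau> > 0"
    using k(4) unfolding \<tau>_def by (intro divide_pos_pos mult_pos_pos Gamma_real_pos) auto
  have tau: "((\<lambda>u. u powr real k * student_t_tail (real k) u) \<longlongrightarrow> \<tau>) at_top"
    unfolding \<tau>_def using k(4) by (intro student_t_tail_asymp) auto
  have "emeasure (span_lborel ?B) {z\<in>span ?B. 0 < Q z \<and> Q z < c\<^sup>2}
    = ennreal ((c / sqrt p) ^ card B1 * (c / sqrt q) ^ card B2 * unit_ball_vol (card ?B))"
    by (rule emeasure_span_lborel_ellipsoid[OF oB disj B_ne pq c]) (auto simp: Q0)
  also have "\<dots> = ennreal (C_const n1 n2 \<alpha> \<beta> * \<tau>)"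
    unfolding cards cB p_def q_def \<tau>_def
    using Student_constant[OF n1(2) n2(2) k(5) \<open>\<alpha> > 0\<close> \<open>\<beta> > 0\<close> c_def] by simp
  finally have vol: "emeasure (span_lborel ?B) {z\<in>span ?B. 0 < Q z \<and> Q z < c\<^sup>2}
    = ennreal (C_const n1 n2 \<alpha> \<beta> * \<tau>)" .
  have prob: "ennreal (\<P>(w in M. T_stat \<alpha> \<beta> (X w) > u)) =
    (\<integral>\<^sup>+x. ennreal (g x) * indicator {x. D x / sqrt (Q x) > u} x \<partial>lborel)" for u
  proof -
    have "{x\<in>space borel. D x / sqrt (Q x) > u} \<in> sets borel" by measurable
    then have A: "{x. D x / sqrt (Q x) > u} \<in> sets lborel" by simp
    have "{w\<in>space M. T_stat \<alpha> \<beta> (X w) > u} = X -` {x. D x / sqrt (Q x) > u} \<inter> space M"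
      by (auto simp: T_stat_def D_def Q_def)
    then show ?thesis
      using distributed_emeasure[OF g_density A] by (simp add: emeasure_eq_measure)
  qed
  have "((\<lambda>u. ennreal (u ^ k) * ennreal (\<P>(w in M. T_stat \<alpha> \<beta> (X w) > u)))
      \<longlongrightarrow> ennreal (C_const n1 n2 \<alpha> \<beta> * \<tau>) * J) at_top"
    using tail_integral_asymp[OF on ne _ _ full g_cont g_nonneg DQ D Q Q_scale Q_nonneg R c \<open>\<epsilon> > 0\<close>, of S]
      notin perp int
    by (simp add: S_def[symmetric] cB vol prob J_def h_def) (simp add: S_def)
  also have "ennreal (C_const n1 n2 \<alpha> \<beta> * \<tau>) * J = ennreal (C_const n1 n2 \<alpha> \<beta> * \<tau> * j)"
    using C_pos \<open>\<tau> > 0\<close> j by (simp add: ennreal_mult)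
  finally have "((\<lambda>u. enn2real (ennreal (u ^ k) * ennreal (\<P>(w in M. T_stat \<alpha> \<beta> (X w) > u))))
      \<longlongrightarrow> C_const n1 n2 \<alpha> \<beta> * \<tau> * j) at_top"
    using C_pos \<open>\<tau> > 0\<close> j by (intro tendsto_enn2real) auto
  then have "((\<lambda>u. enn2real (ennreal (u ^ k) * ennreal (\<P>(w in M. T_stat \<alpha> \<beta> (X w) > u)))
      / (u powr real k * student_t_tail (real k) u)) \<longlongrightarrow> C_const n1 n2 \<alpha> \<beta> * \<tau> * j / \<tau>) at_top"
    using tau \<open>\<tau> > 0\<close> by (intro tendsto_divide) auto
  moreover have "\<forall>\<^sub>F u in at_top. enn2real (ennreal (u ^ k) * ennreal (\<P>(w in M. T_stat \<alpha> \<beta> (X w) > u)))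
      / (u powr real k * student_t_tail (real k) u)
    = \<P>(w in M. T_stat \<alpha> \<beta> (X w) > u) / student_t_tail (real n - 2) u"
    using eventually_gt_at_top[of "0::real"]
    by eventually_elim (simp add: k(3) powr_realpow enn2real_mult)
  ultimately have "((\<lambda>u. \<P>(w in M. T_stat \<alpha> \<beta> (X w) > u) / student_t_tail (real n - 2) u)
      \<longlongrightarrow> C_const n1 n2 \<alpha> \<beta> * j) at_top"
    using \<open>\<tau> > 0\<close> by (auto dest: Lim_transform_eventually)
  then have "((\<lambda>u. \<P>(w in M. T_stat \<alpha> \<beta> (X w) > u) / student_t_tail (real n - 2) u
      - enn2real (K_const \<alpha> \<beta> g)) \<longlongrightarrow> 0) at_top"
    using C_pos j by (simp add: K' LIM_zero)
  then show ?thesis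
    using C_pos j by (auto simp: K' intro!: smalloI_tendsto)
qed

end
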